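(* Let $r>0$ be a real number and let $E_\infty=[-r,r]\subset\mathbb{R}\subset\mathbb{P}^1(\mathbb{R})$. Then the $\delta$-equilibrium measure $\mu_{E_\infty}$ of $E_\infty$ is absolutely continuous with respect to Lebesgue measure on $[-r,r]$, with density given, for almost every $x\in[-r,r]$, by \[ \frac{d\mu_{E_\infty}}{dx}(x)=\begin{cases}\displaystyle \frac{2\arcsin(1/r)}{\pi^2\sqrt{r^2-x^2}}+\frac{1}{\pi^2x}\log\left|\frac{(x+1)\left(r^2-x+\sqrt{r^2-x^2}\sqrt{r^2-1}\right)}{(x-1)\left(r^2+x+\sqrt{r^2-x^2}\sqrt{r^2-1}\right)}\right| & \text{if } r\ge 1,\\[2ex] \displaystyle\frac{1}{\pi\sqrt{r^2-x^2}} & \text{if } r<1,\end{cases} \] and the $\delta$-Robin constant of $E_\infty$ is \[ V_\delta(E_\infty)=\begin{cases}\displaystyle \log\frac{2}{r}+\frac{2}{\pi}\int_1^r\frac{\log x\,dx}{\sqrt{r^2-x^2}}+2\int_1^r\log x\,d\mu_{E_\infty}(x) & \text{if } r\ge1,\\[2ex] \displaystyle\log\frac{2}{r} & \text{if } r<1.\end{cases} \]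
   Context: On $\mathbb{P}^1(\mathbb{R})$, with the usual absolute value $|\cdot|$, the spherical metric is $\delta(x,y)=\frac{|x_0y_1-y_0x_1|}{\max\{|x_0|,|x_1|\}\max\{|y_0|,|y_1|\}}$ for $x=(x_0:x_1)$, $y=(y_0:y_1)$. Regarding $\mathbb{R}$ as a subset of $\mathbb{P}^1(\mathbb{R})$ via $x\mapsto(x:1)$, this means $\delta(x,y)=\frac{|x-y|}{\max\{1,|x|\}\max\{1,|y|\}}$ for $x,y\in\mathbb{R}$. For a Borel probability measure $\nu$ on $\mathbb{P}^1(\mathbb{R})$, the $\delta$-energy is $I_\delta(\nu)=\iint-\log\delta(x,y)\,d\nu(x)\,d\nu(y)$. For a compact set $E$, the $\delta$-Robin constant is $V_\delta(E)=\inf_\nu I_\delta(\nu)$, the infimum being over Borel probability measures $\nu$ supported on $E$. The $\delta$-equilibrium measure $\mu_E$ is the unique Borel probability measure supported on $E$ with $I_\delta(\mu_E)=V_\delta(E)$. *)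

theory Defs
  imports "HOL-Analysis.Analysis" "HOL-Probability.Probability_Measure"
begin

section \<open>The real projective line with the spherical metric\<close>

definition proj_rel :: "real \<times> real \<Rightarrow> real \<times> real \<Rightarrow> bool" where
  "proj_rel v w \<longleftrightarrow> v \<noteq> 0 \<and> (\<exists>c::real. c \<noteq> 0 \<and> w = c *\<^sub>R v)"

lemma part_equivp_proj_rel: "part_equivp proj_rel"
proof (rule part_equivpI)
  show "\<exists>x. proj_rel x x"
    unfolding proj_rel_def by (intro exI[of _ "(1, 1)"] conjI exI[of _ 1]) (auto simp: zero_prod_def)
  show "symp proj_rel"
  proof (rule sympI)
    fix v w assume "proj_rel v w"
    then obtain c where "v \<noteq> 0" "c \<noteq> 0" "w = c *\<^sub>R v" by (auto simp: proj_rel_def)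
    then show "proj_rel w v"
      unfolding proj_rel_def by (intro conjI exI[of _ "inverse c"]) auto
  qed
  show "transp proj_rel"
  proof (rule transpI)
    fix u v w assume "proj_rel u v" "proj_rel v w"
    then obtain c d where "u \<noteq> 0" "c \<noteq> 0" "v = c *\<^sub>R u" "d \<noteq> 0" "w = d *\<^sub>R v"
      by (auto simp: proj_rel_def)
    then show "proj_rel u w"
      unfolding proj_rel_def by (intro conjI exI[of _ "d * c"]) auto
  qed
qed

quotient_type p1 = "real \<times> real" / partial: proj_rel
  by (rule part_equivp_proj_rel)

definition spherical_rep :: "real \<times> real \<Rightarrow> real \<times> real \<Rightarrow> real" where
  "spherical_rep x y =
     \<bar>fst x * snd y - fst y * snd x\<bar> /
     (max \<bar>fst x\<bar> \<bar>snd x\<bar> * max \<bar>fst y\<bar> \<bar>snd y\<bar>)"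

lemma max_abs_pos: "x \<noteq> 0 \<Longrightarrow> 0 < max \<bar>fst x\<bar> \<bar>snd (x :: real \<times> real)\<bar>"
  by (cases x) (auto simp: zero_prod_def less_max_iff_disj)

lemma spherical_rep_scale:
  assumes "c \<noteq> 0" "d \<noteq> 0"
  shows "spherical_rep (c *\<^sub>R x) (d *\<^sub>R y) = spherical_rep x y"
proof -
  have m: "max \<bar>a * s\<bar> \<bar>a * t\<bar> = \<bar>a\<bar> * max \<bar>s\<bar> \<bar>t\<bar>" for a s t :: real
    by (simp add: abs_mult max_mult_distrib_left)
  have e: "c * fst x * (d * snd y) - d * fst y * (c * snd x) =
      (c * d) * (fst x * snd y - fst y * snd x)"
    by (simp add: algebra_simps)
  have d: "(\<bar>c\<bar> * M) * (\<bar>d\<bar> * N) = \<bar>c * d\<bar> * (M * N)" for M N :: real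
    by (simp add: abs_mult)
  have "\<bar>c * d\<bar> \<noteq> 0"
    using assms by simp
  then show ?thesis
    unfolding spherical_rep_def fst_scaleR snd_scaleR real_scaleR_def m e d abs_mult[of "c * d"]
    by (rule mult_divide_mult_cancel_left)
qed

lemma spherical_rep_triangle:
  assumes "x \<noteq> 0" "y \<noteq> 0" "z \<noteq> 0"
  shows "spherical_rep x y \<le> spherical_rep x z + spherical_rep y z"
proof -
  obtain x0 x1 y0 y1 z0 z1 where e: "x = (x0, x1)" "y = (y0, y1)" "z = (z0, z1)"
    by (cases x, cases y, cases z)
  define X where "X = max \<bar>x0\<bar> \<bar>x1\<bar>"
  define Y where "Y = max \<bar>y0\<bar> \<bar>y1\<bar>"
  define Z where "Z = max \<bar>z0\<bar> \<bar>z1\<bar>"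
  have pos: "X > 0" "Y > 0" "Z > 0"
    using assms max_abs_pos[of x] max_abs_pos[of y] max_abs_pos[of z]
    by (simp_all add: e X_def Y_def Z_def)
  define a where "a = \<bar>x0 * y1 - y0 * x1\<bar>"
  define b where "b = \<bar>x0 * z1 - z0 * x1\<bar>"
  define c where "c = \<bar>y0 * z1 - z0 * y1\<bar>"
  have nn: "b \<ge> 0" "c \<ge> 0" by (auto simp: b_def c_def)
  have key: "a * \<bar>t\<bar> \<le> b * Y + c * X"
    if t: "(x0 * y1 - y0 * x1) * t = (x0 * z1 - z0 * x1) * v - (y0 * z1 - z0 * y1) * u"
      and "\<bar>u\<bar> \<le> X" "\<bar>v\<bar> \<le> Y" for t u v
  proof -
    have "a * \<bar>t\<bar> = \<bar>(x0 * z1 - z0 * x1) * v - (y0 * z1 - z0 * y1) * u\<bar>"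
      unfolding a_def abs_mult[symmetric] t ..
    also have "\<dots> \<le> b * \<bar>v\<bar> + c * \<bar>u\<bar>"
      unfolding b_def c_def abs_mult[symmetric] by (rule abs_triangle_ineq4)
    also have "\<dots> \<le> b * Y + c * X"
      using that nn by (intro add_mono mult_left_mono) auto
    finally show ?thesis .
  qed
  have "a * \<bar>z0\<bar> \<le> b * Y + c * X"
    by (rule key[of z0 y0 x0]) (auto simp: X_def Y_def algebra_simps)
  moreover have "a * \<bar>z1\<bar> \<le> b * Y + c * X"
    by (rule key[of z1 y1 x1]) (auto simp: X_def Y_def algebra_simps)
  ultimately have "a * Z \<le> b * Y + c * X"
    by (auto simp: Z_def max_def)
  then have "a / (X * Y) \<le> b / (X * Z) + c / (Y * Z)"
    using pos by (simp add: field_simps)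
  then show ?thesis
    by (simp add: spherical_rep_def e X_def Y_def Z_def a_def b_def c_def)
qed

lemma spherical_rep_eq_0_iff:
  assumes "x \<noteq> 0" "y \<noteq> 0"
  shows "spherical_rep x y = 0 \<longleftrightarrow> proj_rel x y"
proof
  assume "spherical_rep x y = 0"
  moreover obtain x0 x1 y0 y1 where e: "x = (x0, x1)" "y = (y0, y1)"
    by (cases x, cases y)
  ultimately have c: "x0 * y1 = y0 * x1"
    using max_abs_pos[OF assms(1)] max_abs_pos[OF assms(2)] by (simp add: spherical_rep_def)
  show "proj_rel x y"
  proof (cases "x0 = 0")
    case True
    then have "x1 \<noteq> 0" "y0 = 0" "y1 \<noteq> 0"
      using c assms by (auto simp: e zero_prod_def)
    then show ?thesis
      using True assms unfolding proj_rel_def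
      by (intro conjI exI[of _ "y1 / x1"]) (auto simp: e)
  next
    case False
    then have "y0 \<noteq> 0" using c assms by (auto simp: e zero_prod_def)
    then show ?thesis
      using False c assms unfolding proj_rel_def
      by (intro conjI exI[of _ "y0 / x0"]) (auto simp: e field_simps)
  qed
next
  assume "proj_rel x y"
  then show "spherical_rep x y = 0"
    by (auto simp: proj_rel_def spherical_rep_def)
qed

lemma proj_rel_nonzero: "proj_rel x x \<longleftrightarrow> x \<noteq> 0"
  unfolding proj_rel_def by (auto intro: exI[of _ "1::real"])

instantiation p1 :: metric_space
begin

lift_definition dist_p1 :: "p1 \<Rightarrow> p1 \<Rightarrow> real" is spherical_rep
  using spherical_rep_scale by (fastforce simp: proj_rel_def)

definition uniformity_p1 :: "(p1 \<times> p1) filter" where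
  "uniformity_p1 = (INF e\<in>{0 <..}. principal {(x, y). dist x y < e})"

definition open_p1 :: "p1 set \<Rightarrow> bool" where
  "open_p1 U \<longleftrightarrow> (\<forall>x\<in>U. \<forall>\<^sub>F (x', y) in uniformity. x' = x \<longrightarrow> y \<in> U)"

instance
proof
  fix x y z :: p1
  show "dist x y = 0 \<longleftrightarrow> x = y"
    by transfer (auto simp: proj_rel_nonzero spherical_rep_eq_0_iff)
  show "dist x y \<le> dist x z + dist y z"
    by transfer (auto simp: proj_rel_nonzero spherical_rep_triangle)
qed (simp_all add: uniformity_p1_def open_p1_def)

end

lift_definition of_affine :: "real \<Rightarrow> p1" is "\<lambda>x. (x, 1)"
  by (simp add: proj_rel_nonzero zero_prod_def)

text \<open>The coordinate \<open>x\<^sub>0 / x\<^sub>1\<close>; the point at infinity \<open>(1 : 0)\<close> is sent to the junk value 0.\<close>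

lift_definition affine_coord :: "p1 \<Rightarrow> real" is "\<lambda>x. fst x / snd x"
  by (auto simp: proj_rel_def)

lemma affine_coord_of_affine [simp]: "affine_coord (of_affine x) = x"
  by transfer simp

lemma dist_of_affine:
  "dist (of_affine x) (of_affine y) = \<bar>x - y\<bar> / (max 1 \<bar>x\<bar> * max 1 \<bar>y\<bar>)"
  by transfer (simp add: spherical_rep_def max.commute)


section \<open>Energy, Robin constant and equilibrium measure\<close>

definition neg_log_dist :: "p1 \<Rightarrow> p1 \<Rightarrow> ereal" where
  "neg_log_dist x y = (if x = y then \<infinity> else ereal (- ln (dist x y)))"

text \<open>
  The Lebesgue integral of an extended-real function, as the integral of the positive part minus
  that of the negative part (\<open>e2ennreal\<close> sends negative values to 0). The undefined case
  \<open>\<infinity> - \<infinity>\<close> does not arise below: as the spherical metric is at most 2, \<^const>\<open>neg_log_dist\<close>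
  is bounded below by \<open>- ln 2\<close>.
\<close>

definition ereal_integral :: "'a measure \<Rightarrow> ('a \<Rightarrow> ereal) \<Rightarrow> ereal" where
  "ereal_integral M f =
     enn2ereal (\<integral>\<^sup>+ x. e2ennreal (f x) \<partial>M) - enn2ereal (\<integral>\<^sup>+ x. e2ennreal (- f x) \<partial>M)"

definition delta_energy :: "p1 measure \<Rightarrow> ereal" where
  "delta_energy \<nu> = ereal_integral \<nu> (\<lambda>y. ereal_integral \<nu> (\<lambda>x. neg_log_dist x y))"

definition prob_measures_on :: "p1 set \<Rightarrow> p1 measure set" where
  "prob_measures_on E = {\<nu>. prob_space \<nu> \<and> sets \<nu> = sets borel \<and> emeasure \<nu> (- E) = 0}"

definition delta_robin :: "p1 set \<Rightarrow> ereal" where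
  "delta_robin E = (INF \<nu>\<in>prob_measures_on E. delta_energy \<nu>)"

definition delta_equilibrium :: "p1 set \<Rightarrow> p1 measure" where
  "delta_equilibrium E =
     (THE \<mu>. \<mu> \<in> prob_measures_on E \<and> delta_energy \<mu> = delta_robin E)"


section \<open>Intervals in the affine line\<close>

definition affine_interval :: "real \<Rightarrow> p1 set" where
  "affine_interval r = of_affine ` {-r..r}"

lemma dist_of_affine_le: "dist (of_affine x) (of_affine y) \<le> dist x y"
proof -
  have "1 \<le> max 1 \<bar>x\<bar> * max 1 \<bar>y\<bar>"
    using mult_mono[of 1 "max 1 \<bar>x\<bar>" 1 "max 1 \<bar>y\<bar>"] by simp
  then have "\<bar>x - y\<bar> / (max 1 \<bar>x\<bar> * max 1 \<bar>y\<bar>) \<le> \<bar>x - y\<bar> / 1"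
    by (intro divide_left_mono) auto
  then show ?thesis by (simp add: dist_of_affine dist_real_def)
qed

lemma continuous_on_of_affine: "continuous_on A of_affine"
  unfolding continuous_on_iff using dist_of_affine_le by (meson order_le_less_trans)

lemma of_affine_measurable [measurable]: "of_affine \<in> borel \<rightarrow>\<^sub>M borel"
  by (intro borel_measurable_continuous_onI continuous_on_of_affine)

lemma compact_affine_interval: "compact (affine_interval r)"
  unfolding affine_interval_def
  by (intro compact_continuous_image continuous_on_of_affine compact_Icc)

text \<open>Lebesgue measure on \<open>[-r, r]\<close>, regarded as a measure on the projective line.\<close>

definition lebesgue_on_interval :: "real \<Rightarrow> p1 measure" where
  "lebesgue_on_interval r = distr (restrict_space lborel {-r..r}) borel of_affine"

definition equilibrium_density :: "real \<Rightarrow> real \<Rightarrow> real" where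
  "equilibrium_density r x =
     (if r \<ge> 1 then
        2 * arcsin (1 / r) / (pi\<^sup>2 * sqrt (r\<^sup>2 - x\<^sup>2)) +
        1 / (pi\<^sup>2 * x) *
          ln \<bar>((x + 1) * (r\<^sup>2 - x + sqrt (r\<^sup>2 - x\<^sup>2) * sqrt (r\<^sup>2 - 1))) /
              ((x - 1) * (r\<^sup>2 + x + sqrt (r\<^sup>2 - x\<^sup>2) * sqrt (r\<^sup>2 - 1)))\<bar>
      else 1 / (pi * sqrt (r\<^sup>2 - x\<^sup>2)))"

end

theory Submission
  imports Defs "HOL-Probability.Probability"
begin

text \<open>
  Since \<open>- ln \<delta>(x, y) = - ln \<bar>x - y\<bar> + ln\<^sup>+ \<bar>x\<bar> + ln\<^sup>+ \<bar>y\<bar>\<close> on the affine line, the equilibrium measure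
  solves the logarithmic equilibrium problem on \<open>[-r, r]\<close> in the external field \<open>ln\<^sup>+ \<bar>x\<bar>\<close>. It is the
  law of \<open>S cos \<theta>\<close> with \<open>S = min r (1 / \<bar>cos \<psi>\<bar>)\<close>, where \<open>\<psi>\<close> and \<open>\<theta>\<close> are independent and uniform on
  \<open>[0, \<pi>]\<close>, that is, a mixture of arcsine laws. The mean of \<open>ln \<bar>c - cos \<theta>\<bar>\<close> is \<open>- ln 2\<close> for
  \<open>\<bar>c\<bar> \<le> 1\<close>; applying this to either of the two angles shows that the potential of the law is
  \<open>- ln\<^sup>+ \<bar>x\<bar>\<close> plus a constant on \<open>[-r, r]\<close>. Writing \<open>ln (T / \<bar>x - y\<bar>)\<close> as a superposition of products
  of indicator functions of intervals makes the energy positive definite, so this law is the unique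
  minimiser. Its density is the average over \<open>\<psi>\<close> of the arcsine densities on \<open>[-S, S]\<close>.
\<close>

section \<open>Uniform angles and the logarithmic potential of the arcsine law\<close>

text \<open>Why the truncated secant: the arcsine law on \<open>[-u, u]\<close> has logarithmic mean
  \<open>ln u + log_potential (x / u)\<close> at \<open>x\<close>. For
  \<open>u = 1 / \<bar>cos s\<bar>\<close> the second term is
  \<open>log_potential (x * cos s)\<close>, whose mean over \<open>s\<close> is
  \<open>ln (max 1 \<bar>x\<bar>) - ln 2\<close> because the double integral of
  \<open>ln \<bar>x * cos s - cos t\<bar>\<close> can be taken in either order. This is the required
  field, but the radii are unbounded. Cutting them at \<open>r\<close> is harmless for
  \<open>\<bar>x\<bar> \<le> r\<close>: if \<open>r * \<bar>cos s\<bar> \<le> 1\<close>, then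
  \<open>x / r\<close> and \<open>x * cos s\<close> both lie in \<open>[-1, 1]\<close>, where
  \<open>log_potential\<close> is constant, so the cut changes only an additive constant. The
  obstacle on the energy side is that the kernel changes sign and competitors may have infinite
  energy. A scale \<open>T\<close> at least the diameter \<open>2 * r\<close> makes
  \<open>ln (T / \<bar>x - y\<bar>)\<close> nonnegative, all identities are stated additively in
  \<open>ennreal\<close>, and only the finite energy of the candidate is ever cancelled.\<close>

definition angle_measure :: "real measure" where
  "angle_measure = density lborel (\<lambda>x. ennreal (indicator {0..pi} x / pi))"

lemma sets_angle_measure [simp, measurable_cong]: "sets angle_measure = sets borel"
  by (simp add: angle_measure_def)

lemma space_angle_measure [simp]: "space angle_measure = UNIV"
  by (simp add: angle_measure_def)

lemma nn_integral_angle_measure: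
  assumes [measurable]: "f \<in> borel_measurable borel"
  shows "(\<integral>\<^sup>+x. f x \<partial>angle_measure) = ennreal (1 / pi) * (\<integral>\<^sup>+x. f x * indicator {0..pi} x \<partial>lborel)"
proof -
  have "(\<integral>\<^sup>+x. f x \<partial>angle_measure) = (\<integral>\<^sup>+x. ennreal (indicator {0..pi} x / pi) * f x \<partial>lborel)"
    unfolding angle_measure_def by (rule nn_integral_density) auto
  also have "\<dots> = (\<integral>\<^sup>+x. ennreal (1 / pi) * (f x * indicator {0..pi} x) \<partial>lborel)"
    by (intro nn_integral_cong) (auto simp: indicator_def)
  finally show ?thesis
    by (simp add: nn_integral_cmult)
qed

lemma prob_space_angle_measure: "prob_space angle_measure"
proof
  have "emeasure angle_measure (space angle_measure) = (\<integral>\<^sup>+x. 1 \<partial>angle_measure)"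
    by simp
  also have "\<dots> = 1"
    by (subst nn_integral_angle_measure) (auto simp flip: ennreal_mult')
  finally show "emeasure angle_measure (space angle_measure) = 1" .
qed

interpretation angle: prob_space angle_measure
  by (rule prob_space_angle_measure)

interpretation angle_pair: pair_prob_space angle_measure angle_measure ..

lemma AE_angle_measureI:
  assumes "AE x in lborel. x \<in> {0<..<pi} \<longrightarrow> P x"
  shows "AE x in angle_measure. P x"
proof -
  have "AE x in lborel. 0 < ennreal (indicator {0..pi} x / pi) \<longrightarrow> P x"
    using assms AE_lborel_singleton[of 0] AE_lborel_singleton[of pi]
    by eventually_elim (auto simp: indicator_def split: if_splits)
  then show ?thesis
    unfolding angle_measure_def by (subst AE_density) auto
qed

text \<open>Since \<open>ln 0 = 0\<close>, product rules for \<open>ln\<close> fail where the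
  argument vanishes; this discards the single angle where that happens.\<close>

lemma AE_angle_measure_cos_neq: "AE x in angle_measure. cos x \<noteq> c"
proof (rule AE_angle_measureI)
  have "AE x in lborel. x \<noteq> arccos c" by (rule AE_lborel_singleton)
  then show "AE x in lborel. x \<in> {0<..<pi} \<longrightarrow> cos x \<noteq> c"
    by eventually_elim (auto simp: arccos_cos)
qed

lemma nn_integral_arcsine:
  assumes [measurable]: "h \<in> borel_measurable borel" and s: "s > 0"
  shows "(\<integral>\<^sup>+t. h (s * cos t) \<partial>angle_measure) =
    (\<integral>\<^sup>+x. h x * ennreal (indicator {-s..s} x / (pi * sqrt (s\<^sup>2 - x\<^sup>2))) \<partial>lborel)"
proof -
  define f where "f x = h (- x) * ennreal (1 / (pi * sqrt (s\<^sup>2 - x\<^sup>2)))" for x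
  have [measurable]: "f \<in> borel_measurable borel"
    unfolding f_def by measurable
  have sq: "sqrt (s\<^sup>2 - (- s * cos t)\<^sup>2) = s * sin t" if "t \<in> {0..pi}" for t
  proof -
    have "s\<^sup>2 - (- s * cos t)\<^sup>2 = (s * sin t)\<^sup>2"
      by (simp add: power_mult_distrib sin_squared_eq algebra_simps)
    then show ?thesis
      using s that by (simp add: sin_ge_zero)
  qed
  \<comment> \<open>The reflection makes the substitution \<open>- s * cos x\<close>, which is
    increasing on \<open>[0, pi]\<close> with nonnegative derivative
    \<open>s * sin x\<close>.\<close>
  have "(\<integral>\<^sup>+x. h x * ennreal (indicator {-s..s} x / (pi * sqrt (s\<^sup>2 - x\<^sup>2))) \<partial>lborel)
     = (\<integral>\<^sup>+x. h (-x) * ennreal (indicator {-s..s} (-x) / (pi * sqrt (s\<^sup>2 - x\<^sup>2))) \<partial>lborel)"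
    by (subst nn_integral_real_affine[where c = "-1" and t = 0]) auto
  also have "\<dots> = (\<integral>\<^sup>+x. f x * indicator {- s * cos 0..- s * cos pi} x \<partial>lborel)"
    by (intro nn_integral_cong) (auto simp: f_def indicator_def)
  also have "\<dots> = (\<integral>\<^sup>+x. f (- s * cos x) * ennreal (s * sin x) * indicator {0..pi} x \<partial>lborel)"
    using s by (intro nn_integral_substitution_aux)
      (auto intro!: derivative_eq_intros continuous_intros mult_nonneg_nonneg simp: sin_ge_zero)
  also have "\<dots> = (\<integral>\<^sup>+x. ennreal (1 / pi) * (h (s * cos x) * indicator {0..pi} x) \<partial>lborel)"
  proof (intro nn_integral_cong_AE)
    \<comment> \<open>Only almost everywhere: at \<open>0\<close> and \<open>pi\<close> the sine
      vanishes and the left side is zero, while the right side need not be.\<close>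
    show "AE x in lborel. f (- s * cos x) * ennreal (s * sin x) * indicator {0..pi} x =
        ennreal (1 / pi) * (h (s * cos x) * indicator {0..pi} x)"
      using AE_lborel_singleton[of 0] AE_lborel_singleton[of pi]
    proof eventually_elim
      case (elim x)
      show ?case
      proof (cases "x \<in> {0..pi}")
        case True
        then have "sin x > 0" using elim by (auto intro!: sin_gt_zero)
        then have "ennreal (1 / (pi * (s * sin x))) * ennreal (s * sin x) = ennreal (1 / pi)"
          using s by (simp flip: ennreal_mult')
        then show ?thesis
          using True unfolding f_def sq[OF True] by (simp add: mult.assoc) (simp add: mult.commute)
      qed auto
    qed
  qed
  also have "\<dots> = (\<integral>\<^sup>+t. h (s * cos t) \<partial>angle_measure)"
    by (subst nn_integral_angle_measure) (auto simp: nn_integral_cmult)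
  finally show ?thesis ..
qed

lemma emeasure_distr_nn_integral:
  assumes "g \<in> M \<rightarrow>\<^sub>M N" "A \<in> sets N"
  shows "emeasure (distr M N g) A = (\<integral>\<^sup>+x. indicator A (g x) \<partial>M)"
  using assms by (simp flip: nn_integral_indicator add: nn_integral_distr)

lemma distr_angle_measure_uminus_cos:
  "distr angle_measure borel (\<lambda>t. - cos t) = distr angle_measure borel cos"
proof (rule measure_eqI)
  fix A :: "real set" assume "A \<in> sets (distr angle_measure borel (\<lambda>t. - cos t))"
  then have [measurable]: "A \<in> sets borel" by simp
  have "emeasure (distr angle_measure borel (\<lambda>t. - cos t)) A = (\<integral>\<^sup>+x. indicator A (- cos x) \<partial>angle_measure)"
    by (rule emeasure_distr_nn_integral) auto
  also have "\<dots> = ennreal (1 / pi) * (\<integral>\<^sup>+x. indicator A (- cos (pi + - 1 * x)) * indicator {0..pi} (pi + - 1 * x) \<partial>lborel)"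
    by (subst nn_integral_angle_measure, simp)
       (subst nn_integral_real_affine[where c = "-1" and t = pi], auto)
  also have "\<dots> = ennreal (1 / pi) * (\<integral>\<^sup>+x. indicator A (cos x) * indicator {0..pi} x \<partial>lborel)"
    by (intro arg_cong2[where f = "(*)"] refl nn_integral_cong) (auto simp: indicator_def)
  also have "\<dots> = emeasure (distr angle_measure borel cos) A"
    by (subst nn_integral_angle_measure[symmetric], simp)
       (subst emeasure_distr_nn_integral, auto)
  finally show "emeasure (distr angle_measure borel (\<lambda>t. - cos t)) A = emeasure (distr angle_measure borel cos) A" .
qed simp

lemma ennreal_halves: "(x::ennreal) = 2 * a \<Longrightarrow> x = 2 * b \<Longrightarrow> x = a + b"
  by (metis ennreal_mult_cancel_left mult_2 top_neq_numeral zero_neq_numeral)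

text \<open>The doubled angle runs through \<open>[0, 2 * pi]\<close>, and cosine is symmetric about
  \<open>pi\<close>. Hence each half of \<open>[0, pi]\<close> reproduces the full law of the cosine
  with half its mass, by the substitutions \<open>2 * x\<close> and
  \<open>2 * pi - 2 * x\<close>.\<close>

lemma distr_angle_measure_cos_double:
  "distr angle_measure borel (\<lambda>t. cos (2 * t)) = distr angle_measure borel cos"
proof (rule measure_eqI)
  fix A :: "real set" assume "A \<in> sets (distr angle_measure borel (\<lambda>t. cos (2 * t)))"
  then have [measurable]: "A \<in> sets borel" by simp
  define I where "I = (\<integral>\<^sup>+x. indicator A (cos x) * indicator {0..pi} x \<partial>lborel)"
  have "I = (\<integral>\<^sup>+x. 2 * (indicator A (cos (2 * x)) * indicator {0..pi/2} x) \<partial>lborel)"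
    unfolding I_def by (subst nn_integral_real_affine[where c = 2 and t = 0])
      (auto intro!: arg_cong2[where f = "(*)"] nn_integral_cong simp: indicator_def nn_integral_cmult)
  then have 1: "I = 2 * (\<integral>\<^sup>+x. indicator A (cos (2 * x)) * indicator {0..pi/2} x \<partial>lborel)"
    by (simp add: nn_integral_cmult)
  have "cos (2 * pi + - 2 * x) = cos (2 * x)" for x
    using cos_periodic[of "- 2 * x"] by (simp add: add.commute)
  then have "I = 2 * (\<integral>\<^sup>+x. (indicator A (cos (2 * x)) * indicator {pi/2..pi} x) \<partial>lborel)"
    unfolding I_def by (subst nn_integral_real_affine[where c = "-2" and t = "2 * pi"])
      (auto intro!: arg_cong2[where f = "(*)"] nn_integral_cong simp: indicator_def)
  with 1 have "I = (\<integral>\<^sup>+x. indicator A (cos (2 * x)) * indicator {0..pi/2} x \<partial>lborel) +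
      (\<integral>\<^sup>+x. indicator A (cos (2 * x)) * indicator {pi/2..pi} x \<partial>lborel)"
    by (rule ennreal_halves)
  also have "\<dots> = (\<integral>\<^sup>+x. indicator A (cos (2 * x)) * indicator {0..pi/2} x +
      indicator A (cos (2 * x)) * indicator {pi/2..pi} x \<partial>lborel)"
    by (subst nn_integral_add) auto
  also have "\<dots> = (\<integral>\<^sup>+x. indicator A (cos (2 * x)) * indicator {0..pi} x \<partial>lborel)"
    using AE_lborel_singleton[of "pi/2"]
    by (intro nn_integral_cong_AE, eventually_elim) (auto simp: indicator_def)
  finally have I: "I = \<dots>" .
  have "emeasure (distr angle_measure borel (\<lambda>t. cos (2 * t))) A = (\<integral>\<^sup>+x. indicator A (cos (2 * x)) \<partial>angle_measure)"
    by (rule emeasure_distr_nn_integral) auto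
  also have "\<dots> = ennreal (1 / pi) * I"
    unfolding I by (subst nn_integral_angle_measure) auto
  also have "\<dots> = emeasure (distr angle_measure borel cos) A"
    unfolding I_def by (subst nn_integral_angle_measure[symmetric], simp)
       (subst emeasure_distr_nn_integral, auto)
  finally show "emeasure (distr angle_measure borel (\<lambda>t. cos (2 * t))) A = emeasure (distr angle_measure borel cos) A" .
qed simp

lemma
  fixes h :: "real \<Rightarrow> real"
  assumes [measurable]: "h \<in> borel_measurable borel"
  shows integral_angle_uminus_cos:
      "(\<integral>t. h (- cos t) \<partial>angle_measure) = (\<integral>t. h (cos t) \<partial>angle_measure)"
    and integral_angle_cos_double:
      "(\<integral>t. h (cos (2 * t)) \<partial>angle_measure) = (\<integral>t. h (cos t) \<partial>angle_measure)"
proof -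
  have I: "(\<integral>t. h (g t) \<partial>angle_measure) = integral\<^sup>L (distr angle_measure borel g) h"
    if [measurable]: "g \<in> borel_measurable borel" for g
    by (simp add: integral_distr)
  show "(\<integral>t. h (- cos t) \<partial>angle_measure) = (\<integral>t. h (cos t) \<partial>angle_measure)"
    using I[of "\<lambda>t. - cos t"] I[of cos] unfolding distr_angle_measure_uminus_cos by simp
  show "(\<integral>t. h (cos (2 * t)) \<partial>angle_measure) = (\<integral>t. h (cos t) \<partial>angle_measure)"
    using I[of "\<lambda>t. cos (2 * t)"] I[of cos] unfolding distr_angle_measure_cos_double by simp
qed

lemma measure_angle_UNIV [simp]: "measure angle_measure UNIV = 1"
  using angle.prob_space by simp

lemma emeasure_angle_UNIV [simp]: "emeasure angle_measure UNIV = 1"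
  using angle.emeasure_space_1 by simp

section \<open>Integrability of the logarithmic singularity, uniformly in its position\<close>

lemma sin_ge_linear:
  assumes "0 \<le> u" "u \<le> pi / 2"
  shows "2 * u / pi \<le> sin u"
proof -
  have "concave_on {0..pi} sin"
    by (rule f''_le0_imp_concave[where f' = cos and f'' = "\<lambda>x. - sin x"])
       (auto intro!: derivative_eq_intros sin_ge_zero)
  \<comment> \<open>Jordan's inequality: a concave function lies above its chord, here from
    \<open>0\<close> to \<open>pi / 2\<close>.\<close>
  from concave_onD[OF this, of "2 * u / pi" 0 "pi / 2"] show ?thesis
    using assms by (simp add: field_simps)
qed

text \<open>The difference of cosines is, up to sign, twice the product of the sines of
  \<open>(s + t) / 2\<close> and \<open>(s - t) / 2\<close>. The first factor dominates the second
  in absolute value because their squares differ by \<open>sin s * sin t\<close>, which is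
  nonnegative. This leaves \<open>2 * (sin u)\<^sup>2\<close>, and Jordan's inequality
  finishes.\<close>

lemma abs_cos_diff_ge:
  assumes "s \<in> {0..pi}" "t \<in> {0..pi}"
  shows "2 * (s - t)\<^sup>2 / pi\<^sup>2 \<le> \<bar>cos s - cos t\<bar>"
proof -
  define u where "u = \<bar>s - t\<bar> / 2"
  have u: "0 \<le> u" "u \<le> pi / 2" using assms by (auto simp: u_def)
  have odd: "sin ((t - s) / 2) = - sin ((s - t) / 2)"
    using sin_minus[of "(s - t) / 2"] by (simp only: minus_divide_left minus_diff_eq)
  have "(sin a)\<^sup>2 - (sin b)\<^sup>2 = sin (a + b) * sin (a - b)" for a b :: real
  proof -
    have "sin (a + b) * sin (a - b) = (sin a)\<^sup>2 * (cos b)\<^sup>2 - (cos a)\<^sup>2 * (sin b)\<^sup>2"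
      unfolding sin_add sin_diff by (simp add: power2_eq_square algebra_simps)
    also have "\<dots> = (sin a)\<^sup>2 - (sin b)\<^sup>2"
      unfolding cos_squared_eq by (simp add: algebra_simps)
    finally show ?thesis ..
  qed
  from this[of "(s + t) / 2" "(s - t) / 2"]
  have "(sin ((s + t) / 2))\<^sup>2 - (sin ((s - t) / 2))\<^sup>2 = sin s * sin t"
    by (simp flip: add_divide_distrib diff_divide_distrib)
  moreover have "sin s * sin t \<ge> 0" using assms by (simp add: sin_ge_zero)
  ultimately have "\<bar>sin ((s - t) / 2)\<bar> \<le> \<bar>sin ((s + t) / 2)\<bar>"
    by (simp add: abs_le_square_iff)
  moreover have "\<bar>sin ((s - t) / 2)\<bar> = sin u"
  proof -
    have "sin u \<ge> 0" using u by (intro sin_ge_zero) auto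
    moreover have "\<bar>sin ((s - t) / 2)\<bar> = \<bar>sin u\<bar>"
      using odd by (cases "s \<ge> t") (auto simp: u_def)
    ultimately show ?thesis by simp
  qed
  ultimately have "2 * (sin u * sin u) \<le> 2 * (\<bar>sin ((s + t) / 2)\<bar> * \<bar>sin ((s - t) / 2)\<bar>)"
    by (intro mult_left_mono mult_mono) auto
  also have "\<dots> = \<bar>cos s - cos t\<bar>"
    using odd by (subst cos_diff_cos) (simp add: abs_mult)
  finally have "2 * (sin u * sin u) \<le> \<bar>cos s - cos t\<bar>" .
  moreover have "2 * ((2 * u / pi) * (2 * u / pi)) \<le> 2 * (sin u * sin u)"
    using sin_ge_linear[OF u] u sin_ge_zero[of u] by (intro mult_left_mono mult_mono) auto
  moreover have "2 * ((2 * u / pi) * (2 * u / pi)) = 2 * (s - t)\<^sup>2 / pi\<^sup>2"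
    by (simp add: u_def power2_eq_square)
  ultimately show ?thesis by linarith
qed

text \<open>The integrand is unbounded at \<open>s\<close>, but its antiderivatives
  \<open>- 2 * sqrt (s - t)\<close> and \<open>2 * sqrt (t - s)\<close> are continuous up to
  \<open>s\<close>, so the interior form of the fundamental theorem applies on each side.\<close>

lemma has_integral_inverse_sqrt_dist:
  fixes s a b :: real
  assumes "a \<le> s" "s \<le> b"
  shows "((\<lambda>t. 1 / sqrt \<bar>s - t\<bar>) has_integral 2 * sqrt (s - a) + 2 * sqrt (b - s)) {a..b}"
proof (rule has_integral_combine[OF assms])
  have "((\<lambda>t. 1 / sqrt \<bar>s - t\<bar>) has_integral - 2 * sqrt (s - s) - - 2 * sqrt (s - a)) {a..s}"
    by (rule fundamental_theorem_of_calculus_interior[OF assms(1)])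
       (auto intro!: continuous_intros derivative_eq_intros
         simp: has_real_derivative_iff_has_vector_derivative[symmetric] field_simps)
  then show "((\<lambda>t. 1 / sqrt \<bar>s - t\<bar>) has_integral 2 * sqrt (s - a)) {a..s}" by simp
  have "((\<lambda>t. 1 / sqrt \<bar>s - t\<bar>) has_integral 2 * sqrt (b - s) - 2 * sqrt (s - s)) {s..b}"
    by (rule fundamental_theorem_of_calculus_interior[OF assms(2)])
       (auto intro!: continuous_intros derivative_eq_intros
         simp: has_real_derivative_iff_has_vector_derivative[symmetric] field_simps)
  then show "((\<lambda>t. 1 / sqrt \<bar>s - t\<bar>) has_integral 2 * sqrt (b - s)) {s..b}" by simp
qed

lemma nn_integral_inverse_sqrt_dist:
  assumes "s \<in> {0..pi}"
  shows "(\<integral>\<^sup>+t. ennreal (1 / sqrt \<bar>s - t\<bar>) \<partial>angle_measure) \<le> ennreal (4 / sqrt pi)"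
proof -
  have "2 * sqrt (s - 0) + 2 * sqrt (pi - s) \<le> 4 * sqrt pi"
  proof -
    have "sqrt s \<le> sqrt pi" "sqrt (pi - s) \<le> sqrt pi" using assms by auto
    then show ?thesis unfolding diff_0_right by linarith
  qed
  then have "1 / pi * (2 * sqrt (s - 0) + 2 * sqrt (pi - s)) \<le> 1 / pi * (4 * sqrt pi)"
    by (intro mult_left_mono) auto
  also have "1 / pi * (4 * sqrt pi) = 4 / sqrt pi"
    by (simp add: field_simps)
  finally have *: "1 / pi * (2 * sqrt (s - 0) + 2 * sqrt (pi - s)) \<le> 4 / sqrt pi" .
  have "(\<integral>\<^sup>+t. ennreal (1 / sqrt \<bar>s - t\<bar>) \<partial>angle_measure) =
      ennreal (1 / pi) * ennreal (2 * sqrt (s - 0) + 2 * sqrt (pi - s))"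
    using nn_integral_has_integral_lebesgue'[OF _ has_integral_inverse_sqrt_dist[of 0 s pi]] assms
    by (subst nn_integral_angle_measure) auto
  also have "\<dots> \<le> ennreal (4 / sqrt pi)"
    using assms * by (subst ennreal_mult'[symmetric]) (auto intro!: ennreal_leI)
  finally show ?thesis .
qed

lemma
  assumes "s \<in> {0..pi}"
  shows integrable_inverse_sqrt_dist: "integrable angle_measure (\<lambda>t. 1 / sqrt \<bar>s - t\<bar>)"
    and integral_inverse_sqrt_dist_le: "(\<integral>t. 1 / sqrt \<bar>s - t\<bar> \<partial>angle_measure) \<le> 4 / sqrt pi"
proof -
  show i: "integrable angle_measure (\<lambda>t. 1 / sqrt \<bar>s - t\<bar>)"
    using nn_integral_inverse_sqrt_dist[OF assms]
    by (intro integrableI_nonneg) (auto intro: le_less_trans)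
  show "(\<integral>t. 1 / sqrt \<bar>s - t\<bar> \<partial>angle_measure) \<le> 4 / sqrt pi"
    using nn_integral_inverse_sqrt_dist[OF assms] nn_integral_eq_integral[OF i] by simp
qed

lemma AE_angle_measure_mem: "AE t in angle_measure. t \<in> {0..pi}"
  by (rule AE_angle_measureI) auto

text \<open>Trades the logarithmic singularity for an inverse square root, whose integral is
  explicit: \<open>- ln (w\<^sup>2)\<close> is four times \<open>ln (1 / sqrt w)\<close>, and
  \<open>ln z \<le> z - 1\<close>.\<close>

lemma neg_ln_le_inverse_root:
  assumes "v > 0" "w > 0" "w\<^sup>2 \<le> v"
  shows "- ln v \<le> 4 / sqrt w"
proof -
  have "- ln v \<le> - ln (w\<^sup>2)" using assms by simp
  also have "\<dots> = 4 * ln (1 / sqrt w)"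
    using assms by (simp add: ln_div ln_sqrt ln_realpow)
  also have "\<dots> \<le> 4 * (1 / sqrt w)"
    using assms ln_le_minus_one[of "1 / sqrt w"] by simp
  finally show ?thesis by simp
qed

lemma abs_ln_cos_diff_le:
  assumes "s \<in> {0..pi}" "t \<in> {0..pi}"
  shows "\<bar>ln \<bar>cos s - cos t\<bar>\<bar> \<le> 2 + 4 * sqrt pi * (1 / sqrt \<bar>s - t\<bar>)"
proof (cases "cos s = cos t")
  case False
  then have st: "s \<noteq> t" by auto
  \<comment> \<open>With this scaling \<open>w\<^sup>2\<close> is at most the quadratic lower bound
    for the cosine difference.\<close>
  define w where "w = \<bar>s - t\<bar> / pi"
  have w: "w > 0" using st by (simp add: w_def)
  have "w\<^sup>2 \<le> 2 * (s - t)\<^sup>2 / pi\<^sup>2"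
    unfolding w_def power_divide power2_abs by (intro divide_right_mono) auto
  also note abs_cos_diff_ge[OF assms]
  finally have "- ln \<bar>cos s - cos t\<bar> \<le> 4 / sqrt w"
    using False w by (intro neg_ln_le_inverse_root) auto
  also have "\<dots> = 4 * sqrt pi * (1 / sqrt \<bar>s - t\<bar>)"
    by (simp add: w_def real_sqrt_divide)
  finally have 1: "- ln \<bar>cos s - cos t\<bar> \<le> 4 * sqrt pi * (1 / sqrt \<bar>s - t\<bar>)" .
  have "ln \<bar>cos s - cos t\<bar> \<le> \<bar>cos s - cos t\<bar> - 1"
    using False by (intro ln_le_minus_one) auto
  also have "\<dots> \<le> 1"
    using abs_cos_le_one[of s] abs_cos_le_one[of t] by linarith
  finally have 2: "ln \<bar>cos s - cos t\<bar> \<le> 1" .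
  have "0 \<le> 4 * sqrt pi * (1 / sqrt \<bar>s - t\<bar>)" by simp
  then show ?thesis using 1 2 by linarith
qed auto

text \<open>This is the logarithmic potential of the arcsine law on \<open>[-1, 1]\<close> with the
  sign opposite to the usual convention.\<close>

definition log_potential :: "real \<Rightarrow> real" where
  "log_potential c = (\<integral>t. ln \<bar>c - cos t\<bar> \<partial>angle_measure)"

text \<open>The number 18 is \<open>2 + 4 * sqrt pi * (4 / sqrt pi)\<close>. Only its independence
  of \<open>c\<close> matters: it drives the boundedness argument for the doubling equation.\<close>

lemma log_potential_bound:
  assumes "\<bar>c\<bar> \<le> 1"
  shows integrable_ln_cos_diff': "integrable angle_measure (\<lambda>t. ln \<bar>c - cos t\<bar>)"
    and abs_log_potential_le: "\<bar>log_potential c\<bar> \<le> 18"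
proof -
  define s where "s = arccos c"
  have s: "s \<in> {0..pi}" "c = cos s"
    using assms by (auto simp: s_def arccos_lbound arccos_ubound cos_arccos abs_le_iff)
  define g where "g t = 2 + 4 * sqrt pi * (1 / sqrt \<bar>s - t\<bar>)" for t
  have g: "integrable angle_measure g"
    unfolding g_def using integrable_inverse_sqrt_dist[OF s(1)]
    by (intro Bochner_Integration.integrable_add integrable_mult_right) auto
  have le: "AE t in angle_measure. norm (ln \<bar>c - cos t\<bar>) \<le> g t"
    using AE_angle_measure_mem
    unfolding g_def s(2) real_norm_def by eventually_elim (rule abs_ln_cos_diff_le[OF s(1)])
  show i: "integrable angle_measure (\<lambda>t. ln \<bar>c - cos t\<bar>)"
  proof (rule Bochner_Integration.integrable_bound[OF g])
    show "AE t in angle_measure. norm (ln \<bar>c - cos t\<bar>) \<le> norm (g t)"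
      using le by eventually_elim (metis abs_ge_self order_trans real_norm_def)
  qed measurable
  have "\<bar>log_potential c\<bar> \<le> (\<integral>t. norm (ln \<bar>c - cos t\<bar>) \<partial>angle_measure)"
    unfolding log_potential_def using integral_norm_bound[of angle_measure "\<lambda>t. ln \<bar>c - cos t\<bar>"] by simp
  also have "\<dots> \<le> (\<integral>t. g t \<partial>angle_measure)"
    by (rule integral_mono_AE[OF integrable_norm[OF i] g le])
  also have "\<dots> = (\<integral>t. 2 \<partial>angle_measure) + (\<integral>t. 4 * sqrt pi * (1 / sqrt \<bar>s - t\<bar>) \<partial>angle_measure)"
    unfolding g_def
    by (intro Bochner_Integration.integral_add integrable_mult_right integrable_inverse_sqrt_dist s(1)) simp
  also have "\<dots> = 2 + 4 * sqrt pi * (\<integral>t. 1 / sqrt \<bar>s - t\<bar> \<partial>angle_measure)"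
    by (simp only: integral_mult_right_zero) (simp add: angle.prob_space)
  also have "\<dots> \<le> 2 + 4 * sqrt pi * (4 / sqrt pi)"
    by (intro add_mono mult_left_mono integral_inverse_sqrt_dist_le[OF s(1)]) auto
  also have "\<dots> = 18" by simp
  finally show "\<bar>log_potential c\<bar> \<le> 18" .
qed

text \<open>Outside \<open>[-1, 1]\<close> there is no singularity: the argument stays between
  \<open>\<bar>c\<bar> - 1 > 0\<close> and \<open>\<bar>c\<bar> + 1\<close>.\<close>

lemma integrable_ln_cos_diff: "integrable angle_measure (\<lambda>t. ln \<bar>c - cos t\<bar>)"
proof (cases "\<bar>c\<bar> \<le> 1")
  case False
  have "\<bar>ln \<bar>c - cos t\<bar>\<bar> \<le> max \<bar>ln (\<bar>c\<bar> - 1)\<bar> \<bar>ln (\<bar>c\<bar> + 1)\<bar>" for t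
  proof -
    have "\<bar>c\<bar> - 1 \<le> \<bar>c - cos t\<bar>" "\<bar>c - cos t\<bar> \<le> \<bar>c\<bar> + 1"
      using abs_cos_le_one[of t] by linarith+
    then have "ln (\<bar>c\<bar> - 1) \<le> ln \<bar>c - cos t\<bar>" "ln \<bar>c - cos t\<bar> \<le> ln (\<bar>c\<bar> + 1)"
      using False by auto
    then show ?thesis by linarith
  qed
  then show ?thesis
    by (intro angle.integrable_const_bound[where B = "max \<bar>ln (\<bar>c\<bar> - 1)\<bar> \<bar>ln (\<bar>c\<bar> + 1)\<bar>"]) auto
qed (rule integrable_ln_cos_diff')

lemma log_potential_uminus: "log_potential (- c) = log_potential c"
proof -
  have "log_potential (- c) = (\<integral>t. ln \<bar>c - - cos t\<bar> \<partial>angle_measure)"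
    unfolding log_potential_def
    by (intro Bochner_Integration.integral_cong arg_cong[where f = ln]) (auto simp: abs_if)
  also have "\<dots> = log_potential c"
    unfolding log_potential_def by (rule integral_angle_uminus_cos) simp
  finally show ?thesis .
qed

text \<open>As \<open>\<theta>\<close> and \<open>2 \<theta>\<close> have the same cosine in law, the factorisation of
  \<open>cos 2\<phi> - cos 2\<theta>\<close> gives a doubling equation for the potential, whose only bounded solution
  is constant.\<close>

lemma log_potential_cos_double: "log_potential (cos (2 * s)) = ln 2 + 2 * log_potential (cos s)"
proof -
  have "log_potential (cos (2 * s)) = (\<integral>t. ln \<bar>cos (2 * s) - cos (2 * t)\<bar> \<partial>angle_measure)"
    unfolding log_potential_def by (rule integral_angle_cos_double[symmetric]) simp
  also have "\<dots> = (\<integral>t. ln 2 + (ln \<bar>cos s - cos t\<bar> + ln \<bar>- cos s - cos t\<bar>) \<partial>angle_measure)"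
  proof (intro integral_cong_AE)
    show "AE t in angle_measure. ln \<bar>cos (2 * s) - cos (2 * t)\<bar> =
        ln 2 + (ln \<bar>cos s - cos t\<bar> + ln \<bar>- cos s - cos t\<bar>)"
      using AE_angle_measure_cos_neq[of "cos s"] AE_angle_measure_cos_neq[of "- cos s"]
    proof eventually_elim
      case (elim t)
      have "\<bar>cos (2 * s) - cos (2 * t)\<bar> = 2 * (\<bar>cos s - cos t\<bar> * \<bar>- cos s - cos t\<bar>)"
      proof -
        have "cos (2 * s) - cos (2 * t) = - 2 * ((cos s - cos t) * (- cos s - cos t))"
          unfolding cos_double_cos by (simp add: power2_eq_square algebra_simps)
        then show ?thesis by (simp add: abs_mult)
      qed
      moreover have "\<bar>cos s - cos t\<bar> > 0" "\<bar>- cos s - cos t\<bar> > 0" using elim by auto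
      ultimately show ?case by (simp add: ln_mult)
    qed
  qed auto
  also have "\<dots> = ln 2 + (log_potential (cos s) + log_potential (- cos s))"
    using integrable_ln_cos_diff[of "cos s"] integrable_ln_cos_diff[of "- cos s"]
    by (simp add: log_potential_def angle.prob_space)
  finally show ?thesis by (simp add: log_potential_uminus)
qed

lemma log_potential_eq:
  assumes "\<bar>c\<bar> \<le> 1"
  shows "log_potential c = - ln 2"
proof -
  \<comment> \<open>The constant \<open>- ln 2\<close> is the fixed point of
    \<open>v = ln 2 + 2 * v\<close>, so subtracting it makes the doubling equation homogeneous. A
    nonzero value of \<open>B\<close> would grow like \<open>2 ^ n\<close>, past the bound 19, which
    is 18 plus an upper bound for \<open>ln 2\<close>.\<close>
  define B where "B s = log_potential (cos s) + ln 2" for s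
  have double: "B (2 * s) = 2 * B s" for s
    by (simp add: B_def log_potential_cos_double)
  have pow: "B (2 ^ n * s) = 2 ^ n * B s" for n s
    by (induction n) (use double in \<open>simp_all add: mult.assoc\<close>)
  have bound: "\<bar>B s\<bar> \<le> 19" for s
    using abs_log_potential_le[of "cos s", OF abs_cos_le_one] ln_2_less_1 ln_gt_zero[of "2::real"]
    unfolding B_def by linarith
  have "B s = 0" for s
  proof (rule ccontr)
    assume "B s \<noteq> 0"
    then obtain n where "19 / \<bar>B s\<bar> < 2 ^ n"
      using real_arch_pow[of 2] by auto
    then have "19 < \<bar>B (2 ^ n * s)\<bar>"
      using \<open>B s \<noteq> 0\<close> unfolding pow by (simp add: abs_mult field_simps)
    then show False using bound[of "2 ^ n * s"] by simp
  qed
  from this[of "arccos c"] show ?thesis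
    using assms by (simp add: B_def cos_arccos_abs)
qed

section \<open>Positive definiteness of the logarithmic kernel\<close>

text \<open>The conversion to \<open>ennreal\<close> loses nothing as long as
  \<open>\<bar>x - y\<bar> \<le> T\<close>. The diagonal needs its own clause because division by
  zero and \<open>ln 0\<close> would otherwise make the kernel vanish there.\<close>

definition log_kernel :: "real \<Rightarrow> real \<Rightarrow> real \<Rightarrow> ennreal" where
  "log_kernel T x y = (if x = y then \<infinity> else ennreal (ln (T / \<bar>x - y\<bar>)))"

lemma log_kernel_measurable [measurable]:
  "case_prod (log_kernel T) \<in> borel_measurable (borel \<Otimes>\<^sub>M borel)"
  unfolding log_kernel_def by measurable

text \<open>As \<open>ln (T / u)\<close> is the integral of \<open>(min t T - u)\<^sup>+ / t\<^sup>2\<close> over \<open>t > 0\<close>, and \<open>(min t T - \<bar>x - y\<bar>)\<^sup>+\<close>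
  is the measure of those \<open>a\<close> for which \<open>[a, a + min t T]\<close> contains \<open>x\<close> and \<open>y\<close>, the kernel is a
  superposition of products of indicator functions of such intervals.\<close>

definition window :: "real \<Rightarrow> real \<times> real \<Rightarrow> real set" where
  "window T p = {snd p..snd p + min (fst p) T}"

definition window_weight :: "real \<times> real \<Rightarrow> ennreal" where
  "window_weight p = ennreal (indicator {0<..} (fst p) / (fst p)\<^sup>2)"

lemma window_weight_measurable [measurable]: "window_weight \<in> borel_measurable borel"
  unfolding window_weight_def borel_prod[symmetric] by measurable

lemma indicator_window_measurable [measurable]:
  "(\<lambda>(p, x). indicator (window T p) x :: ennreal) \<in> borel_measurable (borel \<Otimes>\<^sub>M borel)"
proof -
  have "(\<lambda>(p, x). indicator (window T p) x :: ennreal) =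
      (\<lambda>(p, x). if snd p \<le> x \<and> x \<le> snd p + min (fst p) T then 1 else 0)"
    by (auto simp: window_def indicator_def fun_eq_iff)
  also have "\<dots> \<in> borel_measurable (borel \<Otimes>\<^sub>M borel)"
    unfolding borel_prod[symmetric] by measurable
  finally show ?thesis .
qed

text \<open>The part over \<open>[u, T]\<close> has antiderivative \<open>ln t + u / t\<close> and
  contributes \<open>ln (T / u) + u / T - 1\<close>. The tail over \<open>[T, \<infinity>)\<close>
  contributes \<open>1 - u / T\<close>, so the surplus cancels. Below \<open>u\<close> the
  conversion to \<open>ennreal\<close> truncates the integrand to zero.\<close>

lemma nn_integral_window_weight:
  assumes "0 < u" "u \<le> T"
  shows "(\<integral>\<^sup>+t. ennreal (indicator {0<..} t / t\<^sup>2) * ennreal (min t T - u) \<partial>lborel) = ennreal (ln (T / u))"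
proof -
  have 1: "(\<integral>\<^sup>+t. ennreal ((t - u) / t\<^sup>2) * indicator {u..T} t \<partial>lborel) =
      ennreal ((ln T + u / T) - (ln u + u / u))"
    using assms by (intro nn_integral_FTC_Icc)
      (auto intro!: derivative_eq_intros simp: field_simps power2_eq_square)
  have "((\<lambda>t. - (T - u) / t) \<longlongrightarrow> 0) at_top"
    by real_asymp
  then have 2: "(\<integral>\<^sup>+t. ennreal ((T - u) / t\<^sup>2) * indicator {T..} t \<partial>lborel) = ennreal (0 - - (T - u) / T)"
    using assms by (intro nn_integral_FTC_atLeast)
      (auto intro!: derivative_eq_intros simp: field_simps power2_eq_square)
  have "(\<integral>\<^sup>+t. ennreal (indicator {0<..} t / t\<^sup>2) * ennreal (min t T - u) \<partial>lborel) =
     (\<integral>\<^sup>+t. (ennreal ((t - u) / t\<^sup>2) * indicator {u..T} t + ennreal ((T - u) / t\<^sup>2) * indicator {T..} t) \<partial>lborel)"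
  proof (intro nn_integral_cong_AE)
    show "AE t in lborel. ennreal (indicator {0<..} t / t\<^sup>2) * ennreal (min t T - u) =
        ennreal ((t - u) / t\<^sup>2) * indicator {u..T} t + ennreal ((T - u) / t\<^sup>2) * indicator {T..} t"
      using AE_lborel_singleton[of T]
    proof eventually_elim
      case (elim t)
      consider "t < u" | "u \<le> t" "t < T" | "T < t" using elim by linarith
      then show ?case
        using assms by cases (auto simp: indicator_def ennreal_neg simp flip: ennreal_mult'')
    qed
  qed
  also have "\<dots> = ennreal ((ln T + u / T) - (ln u + u / u)) + ennreal (0 - - (T - u) / T)"
    by (subst nn_integral_add) (auto simp: 1 2)
  also have "\<dots> = ennreal ((ln T + u / T) - (ln u + u / u) + (0 - - (T - u) / T))"
  proof (rule ennreal_plus[symmetric])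
    have "ln (u / T) \<le> u / T - 1" using assms by (intro ln_le_minus_one) auto
    then show "0 \<le> (ln T + u / T) - (ln u + u / u)" using assms by (simp add: ln_div)
  qed (use assms in \<open>auto simp: divide_le_0_iff\<close>)
  also have "(ln T + u / T) - (ln u + u / u) + (0 - - (T - u) / T) = ln (T / u)"
    using assms by (simp add: ln_div field_simps)
  finally show ?thesis .
qed

lemma nn_integral_window_weight_0:
  assumes "0 < T"
  shows "(\<integral>\<^sup>+t. ennreal (indicator {0<..} t / t\<^sup>2) * ennreal (min t T) \<partial>lborel) = \<infinity>"
proof (rule ccontr)
  let ?I = "\<integral>\<^sup>+t. ennreal (indicator {0<..} t / t\<^sup>2) * ennreal (min t T) \<partial>lborel"
  assume "?I \<noteq> \<infinity>"
  then obtain c where c: "?I = ennreal c" "c \<ge> 0" by (cases ?I) auto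
  \<comment> \<open>Chosen so that \<open>ln (T / u) = c + 1\<close>: the off-diagonal integral at
    distance \<open>u\<close> is a lower bound that exceeds the supposed finite value
    \<open>c\<close>.\<close>
  define u where "u = T / exp (c + 1)"
  have u: "0 < u" "u \<le> T" using assms c by (auto simp: u_def field_simps)
  have "ennreal (c + 1) = ennreal (ln (T / u))" using assms by (simp add: u_def)
  also have "\<dots> \<le> ?I"
    unfolding nn_integral_window_weight[OF u, symmetric]
    using u by (intro nn_integral_mono mult_left_mono ennreal_leI) auto
  finally show False using c by simp
qed

lemma log_kernel_eq_window:
  assumes "0 < T" "\<bar>x - y\<bar> \<le> T"
  shows "(\<integral>\<^sup>+p. window_weight p * (indicator (window T p) x * indicator (window T p) y) \<partial>lborel) = log_kernel T x y"
proof -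
  have m[measurable]: "(\<lambda>p. indicator (window T p) z :: ennreal) \<in> borel_measurable (borel \<Otimes>\<^sub>M borel)" for z
    using measurable_compose_Pair1[of z] indicator_window_measurable[of T]
    unfolding borel_prod by measurable
  have "(\<integral>\<^sup>+p. window_weight p * (indicator (window T p) x * indicator (window T p) y) \<partial>lborel) =
     (\<integral>\<^sup>+t. (\<integral>\<^sup>+a. window_weight (t, a) * (indicator (window T (t, a)) x * indicator (window T (t, a)) y) \<partial>lborel) \<partial>lborel)"
    unfolding lborel_prod[symmetric]
    by (rule lborel.nn_integral_fst[symmetric])
       (use window_weight_measurable m in \<open>simp add: borel_prod lborel_prod\<close>)
  also have "\<dots> = (\<integral>\<^sup>+t. ennreal (indicator {0<..} t / t\<^sup>2) * ennreal (min t T - \<bar>x - y\<bar>) \<partial>lborel)"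
  proof (intro nn_integral_cong)
    fix t
    \<comment> \<open>For fixed \<open>t\<close>, the window contains both points exactly when its
      left end lies between \<open>max x y - min t T\<close> and \<open>min x y\<close>.\<close>
    have "(\<integral>\<^sup>+a. window_weight (t, a) * (indicator (window T (t, a)) x * indicator (window T (t, a)) y) \<partial>lborel) =
       (\<integral>\<^sup>+a. ennreal (indicator {0<..} t / t\<^sup>2) * indicator {max x y - min t T..min x y} a \<partial>lborel)"
      by (intro nn_integral_cong) (auto simp: window_weight_def window_def indicator_def)
    also have "\<dots> = ennreal (indicator {0<..} t / t\<^sup>2) * ennreal (min t T - \<bar>x - y\<bar>)"
    proof -
      have *: "min x y - (max x y - min t T) = min t T - \<bar>x - y\<bar>" by linarith
      have "emeasure lborel {max x y - min t T..min x y} = ennreal (min t T - \<bar>x - y\<bar>)"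
      proof (cases "max x y - min t T \<le> min x y")
        case True
        then show ?thesis unfolding emeasure_lborel_Icc_eq * by simp
      next
        case False
        then have "min t T - \<bar>x - y\<bar> \<le> 0" using * by linarith
        then show ?thesis using False by (simp add: ennreal_neg)
      qed
      then show ?thesis by (subst nn_integral_cmult_indicator) auto
    qed
    finally show "(\<integral>\<^sup>+a. window_weight (t, a) * (indicator (window T (t, a)) x * indicator (window T (t, a)) y) \<partial>lborel) = \<dots>" .
  qed
  also have "\<dots> = log_kernel T x y"
    using assms nn_integral_window_weight[of "\<bar>x - y\<bar>" T] nn_integral_window_weight_0[of T]
    by (auto simp: log_kernel_def)
  finally show ?thesis .
qed

definition log_energy :: "real \<Rightarrow> real measure \<Rightarrow> real measure \<Rightarrow> ennreal" where
  "log_energy T \<alpha> \<beta> = (\<integral>\<^sup>+x. \<integral>\<^sup>+y. log_kernel T x y \<partial>\<beta> \<partial>\<alpha>)"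

lemma emeasure_window_measurable [measurable]:
  assumes "sigma_finite_measure \<alpha>" and [measurable_cong]: "sets \<alpha> = sets borel"
  shows "(\<lambda>p. emeasure \<alpha> (window T p)) \<in> borel_measurable borel"
proof -
  interpret sigma_finite_measure \<alpha> by fact
  have "(\<lambda>p. emeasure \<alpha> (window T p)) = (\<lambda>p. \<integral>\<^sup>+x. indicator (window T p) x \<partial>\<alpha>)"
    by (simp add: assms(2) window_def)
  then show ?thesis by simp
qed

text \<open>The window representation is inserted and Tonelli applied once for each measure, which
  separates the two variables. The supports and \<open>2 * r \<le> T\<close> keep
  \<open>\<bar>x - y\<bar> \<le> T\<close> almost everywhere, the range in which the representation
  holds.\<close>

lemma log_energy_eq_window:
  assumes "prob_space \<alpha>" "prob_space \<beta>"
    and [measurable_cong, simp]: "sets \<alpha> = sets borel" "sets \<beta> = sets borel"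
    and supp: "AE x in \<alpha>. \<bar>x\<bar> \<le> r" "AE x in \<beta>. \<bar>x\<bar> \<le> r"
    and "0 < T" "2 * r \<le> T"
  shows "log_energy T \<alpha> \<beta> =
    (\<integral>\<^sup>+p. window_weight p * (emeasure \<alpha> (window T p) * emeasure \<beta> (window T p)) \<partial>lborel)"
proof -
  interpret \<alpha>: prob_space \<alpha> by fact
  interpret \<beta>: prob_space \<beta> by fact
  interpret pa: pair_sigma_finite "lborel :: (real \<times> real) measure" \<alpha> ..
  interpret pb: pair_sigma_finite "lborel :: (real \<times> real) measure" \<beta> ..
  note [measurable] = emeasure_window_measurable[OF \<beta>.sigma_finite_measure_axioms assms(4)]
    emeasure_window_measurable[OF \<alpha>.sigma_finite_measure_axioms assms(3)]
  have [measurable]: "(\<lambda>p. indicator (window T p) x :: ennreal) \<in> borel_measurable borel" for x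
    using indicator_window_measurable[of T] by measurable
  have [measurable]: "window T p \<in> sets borel" for p by (simp add: window_def)
  have "log_energy T \<alpha> \<beta> = (\<integral>\<^sup>+x. \<integral>\<^sup>+p. window_weight p * (indicator (window T p) x * emeasure \<beta> (window T p)) \<partial>lborel \<partial>\<alpha>)"
    unfolding log_energy_def
  proof (intro nn_integral_cong_AE, use supp(1) in eventually_elim)
    case (elim x)
    have "(\<integral>\<^sup>+y. log_kernel T x y \<partial>\<beta>) =
        (\<integral>\<^sup>+y. \<integral>\<^sup>+p. window_weight p * (indicator (window T p) x * indicator (window T p) y) \<partial>lborel \<partial>\<beta>)"
      using supp(2) by (intro nn_integral_cong_AE, eventually_elim)
        (use elim assms in \<open>auto intro!: log_kernel_eq_window[symmetric]\<close>)
    also have "\<dots> = (\<integral>\<^sup>+p. \<integral>\<^sup>+y. window_weight p * (indicator (window T p) x * indicator (window T p) y) \<partial>\<beta> \<partial>lborel)"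
      by (rule pb.Fubini') measurable
    also have "\<dots> = (\<integral>\<^sup>+p. window_weight p * (indicator (window T p) x * emeasure \<beta> (window T p)) \<partial>lborel)"
      by (intro nn_integral_cong) (simp add: nn_integral_cmult)
    finally show ?case .
  qed
  also have "\<dots> = (\<integral>\<^sup>+p. \<integral>\<^sup>+x. window_weight p * (indicator (window T p) x * emeasure \<beta> (window T p)) \<partial>\<alpha> \<partial>lborel)"
    by (rule pa.Fubini') measurable
  also have "\<dots> = (\<integral>\<^sup>+p. window_weight p * (emeasure \<alpha> (window T p) * emeasure \<beta> (window T p)) \<partial>lborel)"
    by (intro nn_integral_cong) (simp add: nn_integral_cmult nn_integral_multc)
  finally show ?thesis .
qed

text \<open>The energy of the signed measure \<open>\<alpha> - \<beta>\<close>, written as an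
  integral of squares so that no infinite energies are subtracted and nonnegativity is
  evident.\<close>

definition window_defect :: "real \<Rightarrow> real measure \<Rightarrow> real measure \<Rightarrow> ennreal" where
  "window_defect T \<alpha> \<beta> =
     (\<integral>\<^sup>+p. window_weight p * ennreal ((measure \<alpha> (window T p) - measure \<beta> (window T p))\<^sup>2) \<partial>lborel)"

text \<open>Window by window this is \<open>a * a + b * b = 2 * (a * b) + (a - b)\<^sup>2\<close>.
  The additive form stays meaningful when some energies are infinite.\<close>

lemma log_energy_polarization:
  assumes "prob_space \<alpha>" "prob_space \<beta>"
    and [measurable_cong, simp]: "sets \<alpha> = sets borel" "sets \<beta> = sets borel"
    and supp: "AE x in \<alpha>. \<bar>x\<bar> \<le> r" "AE x in \<beta>. \<bar>x\<bar> \<le> r"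
    and T: "0 < T" "2 * r \<le> T"
  shows "log_energy T \<alpha> \<alpha> + log_energy T \<beta> \<beta> = 2 * log_energy T \<alpha> \<beta> + window_defect T \<alpha> \<beta>"
proof -
  interpret \<alpha>: prob_space \<alpha> by fact
  interpret \<beta>: prob_space \<beta> by fact
  note [measurable] = emeasure_window_measurable[OF \<beta>.sigma_finite_measure_axioms assms(4)]
    emeasure_window_measurable[OF \<alpha>.sigma_finite_measure_axioms assms(3)]
  have [measurable]: "(\<lambda>p. measure \<alpha> (window T p)) \<in> borel_measurable borel"
    "(\<lambda>p. measure \<beta> (window T p)) \<in> borel_measurable borel"
    unfolding measure_def by measurable
  define a where "a p = measure \<alpha> (window T p)" for p
  define b where "b p = measure \<beta> (window T p)" for p
  have [measurable]: "a \<in> borel_measurable borel" "b \<in> borel_measurable borel"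
    unfolding a_def b_def by measurable
  have nn: "a p \<ge> 0" "b p \<ge> 0" for p by (auto simp: a_def b_def)
  have e: "emeasure \<alpha> (window T p) = ennreal (a p)" "emeasure \<beta> (window T p) = ennreal (b p)" for p
    by (auto simp: a_def b_def \<alpha>.emeasure_eq_measure \<beta>.emeasure_eq_measure)
  have 1: "log_energy T \<alpha> \<alpha> = (\<integral>\<^sup>+p. window_weight p * ennreal (a p * a p) \<partial>lborel)"
    using log_energy_eq_window[OF assms(1,1) assms(3,3) supp(1,1) T] nn by (simp add: e ennreal_mult)
  have 2: "log_energy T \<beta> \<beta> = (\<integral>\<^sup>+p. window_weight p * ennreal (b p * b p) \<partial>lborel)"
    using log_energy_eq_window[OF assms(2,2) assms(4,4) supp(2,2) T] nn by (simp add: e ennreal_mult)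
  have 3: "log_energy T \<alpha> \<beta> = (\<integral>\<^sup>+p. window_weight p * ennreal (a p * b p) \<partial>lborel)"
    using log_energy_eq_window[OF assms(1,2,3,4) supp T] nn by (simp add: e ennreal_mult)
  have "log_energy T \<alpha> \<alpha> + log_energy T \<beta> \<beta> =
      (\<integral>\<^sup>+p. window_weight p * ennreal (a p * a p) + window_weight p * ennreal (b p * b p) \<partial>lborel)"
    unfolding 1 2 by (rule nn_integral_add[symmetric]) auto
  also have "\<dots> = (\<integral>\<^sup>+p. 2 * (window_weight p * ennreal (a p * b p)) + window_weight p * ennreal ((a p - b p)\<^sup>2) \<partial>lborel)"
  proof (intro nn_integral_cong)
    fix p
    have *: "ennreal (a p * a p) + ennreal (b p * b p) = 2 * ennreal (a p * b p) + ennreal ((a p - b p)\<^sup>2)"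
    proof -
      have "ennreal (a p * a p) + ennreal (b p * b p) = ennreal (a p * a p + b p * b p)"
        using nn[of p] by simp
      also have "a p * a p + b p * b p = 2 * (a p * b p) + (a p - b p)\<^sup>2"
        by (simp add: power2_eq_square algebra_simps)
      also have "ennreal \<dots> = ennreal (2 * (a p * b p)) + ennreal ((a p - b p)\<^sup>2)"
        using nn[of p] by (intro ennreal_plus) auto
      also have "ennreal (2 * (a p * b p)) = 2 * ennreal (a p * b p)"
        using nn[of p] by (subst ennreal_mult) auto
      finally show ?thesis .
    qed
    have "window_weight p * ennreal (a p * a p) + window_weight p * ennreal (b p * b p) =
       window_weight p * (2 * ennreal (a p * b p) + ennreal ((a p - b p)\<^sup>2))"
      unfolding *[symmetric] by (rule distrib_left[symmetric])
    also have "\<dots> = 2 * (window_weight p * ennreal (a p * b p)) + window_weight p * ennreal ((a p - b p)\<^sup>2)"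
      unfolding distrib_left by (simp only: mult.left_commute)
    finally show "window_weight p * ennreal (a p * a p) + window_weight p * ennreal (b p * b p) = \<dots>" .
  qed
  also have "\<dots> = 2 * log_energy T \<alpha> \<beta> + window_defect T \<alpha> \<beta>"
    unfolding 3 window_defect_def a_def[symmetric] b_def[symmetric]
    by (subst nn_integral_add) (auto simp: nn_integral_cmult)
  finally show ?thesis .
qed

section \<open>Zero defect determines the measure\<close>

lemma AE_lborel_ex_between:
  fixes c d :: real
  assumes "AE x in lborel. P x" "c < d"
  obtains x where "c < x" "x < d" "P x"
proof -
  have "\<exists>x. c < x \<and> x < d \<and> P x"
  proof (rule ccontr)
    assume *: "\<nexists>x. c < x \<and> x < d \<and> P x"
    have "AE x in lborel. x \<notin> {c<..<d}"
      using assms(1) by eventually_elim (use * in auto)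
    then have "emeasure lborel {c<..<d} = 0"
      by (subst (asm) AE_iff_null_sets[symmetric]) (auto simp: null_sets_def)
    then show False using assms(2) by simp
  qed
  then show ?thesis using that by blast
qed

text \<open>The two measures agree on almost every window. A window of length
  \<open>T \<ge> 2 * r\<close> whose left end is below \<open>- r\<close> sees everything up to its
  right end, so its mass is a value of the distribution function. The distribution functions thus
  agree at almost every point just to the right of any \<open>c < r\<close>, and right continuity
  gives equality at \<open>c\<close>.\<close>

lemma window_defect_eq_0:
  assumes "prob_space \<alpha>" "prob_space \<beta>"
    and [measurable_cong, simp]: "sets \<alpha> = sets borel" "sets \<beta> = sets borel"
    and supp: "AE x in \<alpha>. \<bar>x\<bar> \<le> r" "AE x in \<beta>. \<bar>x\<bar> \<le> r"
    and T: "0 < T" "2 * r \<le> T"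
    and defect: "window_defect T \<alpha> \<beta> = 0"
  shows "\<alpha> = \<beta>"
proof -
  interpret \<alpha>: prob_space \<alpha> by fact
  interpret \<beta>: prob_space \<beta> by fact
  interpret \<alpha>: real_distribution \<alpha> by unfold_locales simp
  interpret \<beta>: real_distribution \<beta> by unfold_locales simp
  note [measurable] = emeasure_window_measurable[OF \<beta>.sigma_finite_measure_axioms assms(4)]
    emeasure_window_measurable[OF \<alpha>.sigma_finite_measure_axioms assms(3)]
  have [measurable]: "(\<lambda>p. measure \<alpha> (window T p)) \<in> borel_measurable borel"
    "(\<lambda>p. measure \<beta> (window T p)) \<in> borel_measurable borel"
    unfolding measure_def by measurable
  have "AE p in lborel. window_weight p * ennreal ((measure \<alpha> (window T p) - measure \<beta> (window T p))\<^sup>2) = 0"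
    using defect unfolding window_defect_def by (subst (asm) nn_integral_0_iff_AE) auto
  then have "AE p in lborel \<Otimes>\<^sub>M lborel. fst p > 0 \<longrightarrow> measure \<alpha> (window T p) = measure \<beta> (window T p)"
    unfolding lborel_prod
    by eventually_elim (auto simp: window_weight_def ennreal_eq_0_iff divide_le_0_iff)
  from lborel_pair.AE_pair[OF this] have "AE t in lborel. AE a in lborel. t > 0 \<longrightarrow>
      measure \<alpha> (window T (t, a)) = measure \<beta> (window T (t, a))"
    unfolding fst_conv .
  \<comment> \<open>Any \<open>t > T\<close> makes \<open>min t T = T\<close>, so one good
    \<open>t\<close> yields windows of length exactly \<open>T\<close>.\<close>
  from AE_lborel_ex_between[OF this, of T "T + 1"] obtain t where t: "T < t"
    "AE a in lborel. t > 0 \<longrightarrow> measure \<alpha> (window T (t, a)) = measure \<beta> (window T (t, a))"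
    by auto
  then have AE: "AE a in lborel. measure \<alpha> {a..a + T} = measure \<beta> {a..a + T}"
    using T by (simp add: window_def)
  have cdf_window: "measure M {a..a + T} = cdf M (a + T)"
    if "prob_space M" "sets M = sets borel" "AE x in M. \<bar>x\<bar> \<le> r" "a < - r" for M a
  proof -
    interpret M: prob_space M by fact
    show ?thesis
      unfolding cdf_def using that(3)
      by (intro M.finite_measure_eq_AE, eventually_elim) (use that in auto)
  qed
  have cdf_ge: "cdf M c = 1"
    if "prob_space M" "sets M = sets borel" "AE x in M. \<bar>x\<bar> \<le> r" "c \<ge> r" for M c
  proof -
    interpret M: prob_space M by fact
    have "AE x in M. x \<in> {..c}"
      using that(3) by eventually_elim (use that in auto)
    then show ?thesis
      unfolding cdf_def using that by (subst M.prob_eq_1) auto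
  qed
  have "cdf \<alpha> c = cdf \<beta> c" for c
  proof (cases "c \<ge> r")
    case True
    then show ?thesis using assms by (simp add: cdf_ge)
  next
    case False
    show ?thesis
    proof (rule ccontr)
      assume ne: "cdf \<alpha> c \<noteq> cdf \<beta> c"
      have "((\<lambda>x. cdf \<alpha> x - cdf \<beta> x) \<longlongrightarrow> cdf \<alpha> c - cdf \<beta> c) (at_right c)"
        using \<alpha>.cdf_is_right_cont[of c] \<beta>.cdf_is_right_cont[of c]
        by (intro tendsto_diff) (auto simp: continuous_within)
      then have "eventually (\<lambda>x. cdf \<alpha> x - cdf \<beta> x \<noteq> 0) (at_right c)"
        by (rule tendsto_imp_eventually_ne) (use ne in auto)
      then obtain d where d: "d > c" "\<And>x. c < x \<Longrightarrow> x < d \<Longrightarrow> cdf \<alpha> x \<noteq> cdf \<beta> x"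
        by (auto simp: eventually_at_right_field)
      \<comment> \<open>The right end \<open>a + T\<close> falls in \<open>(c, d)\<close>, where the
        distribution functions differ, and \<open>a < r - T \<le> - r\<close> keeps the left end
        clear of the support.\<close>
      from AE_lborel_ex_between[OF AE, of "c - T" "min d r - T"]
      obtain a where "c - T < a" "a < min d r - T" "measure \<alpha> {a..a + T} = measure \<beta> {a..a + T}"
        using d False by auto
      then show False
        using d(2)[of "a + T"] cdf_window[of \<alpha> a] cdf_window[of \<beta> a] assms by auto
    qed
  qed
  then show ?thesis
    by (intro cdf_unique \<alpha>.real_distribution_axioms \<beta>.real_distribution_axioms ext)
qed

section \<open>Minimality and uniqueness from a constant weighted potential\<close>

definition field_energy :: "real \<Rightarrow> real measure \<Rightarrow> ennreal" where
  "field_energy T \<nu> = log_energy T \<nu> \<nu> + 2 * (\<integral>\<^sup>+x. ennreal (ln (max 1 \<bar>x\<bar>)) \<partial>\<nu>)"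

text \<open>Because \<open>pot\<close> holds on the whole interval, the mixed energy of any
  competitor with \<open>\<mu>\<close> plus the field integral of the competitor is
  \<open>K\<close>. In the polarization identity the cross term is therefore the same for all
  competitors, and the excess energy of \<open>\<nu>\<close> over \<open>\<mu>\<close> is exactly
  the defect.\<close>

lemma field_energy_Frostman:
  assumes "prob_space \<mu>" and [measurable_cong, simp]: "sets \<mu> = sets borel"
    and supp: "AE x in \<mu>. \<bar>x\<bar> \<le> r"
    and T: "0 < T" "2 * r \<le> T"
    and pot: "\<And>x. \<bar>x\<bar> \<le> r \<Longrightarrow> (\<integral>\<^sup>+y. log_kernel T x y \<partial>\<mu>) + ennreal (ln (max 1 \<bar>x\<bar>)) = ennreal K"
  shows field_energy_equilibrium: "field_energy T \<mu> = ennreal K + (\<integral>\<^sup>+x. ennreal (ln (max 1 \<bar>x\<bar>)) \<partial>\<mu>)"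
    and field_energy_ge: "\<And>\<nu>. prob_space \<nu> \<Longrightarrow> sets \<nu> = sets borel \<Longrightarrow> AE x in \<nu>. \<bar>x\<bar> \<le> r \<Longrightarrow>
      field_energy T \<mu> \<le> field_energy T \<nu>"
    and field_energy_unique: "\<And>\<nu>. prob_space \<nu> \<Longrightarrow> sets \<nu> = sets borel \<Longrightarrow> AE x in \<nu>. \<bar>x\<bar> \<le> r \<Longrightarrow>
      field_energy T \<nu> = field_energy T \<mu> \<Longrightarrow> \<nu> = \<mu>"
proof -
  interpret \<mu>: prob_space \<mu> by fact
  define Q where "Q \<nu> = (\<integral>\<^sup>+x. ennreal (ln (max 1 \<bar>x\<bar>)) \<partial>\<nu>)" for \<nu> :: "real measure"
  have mixed: "log_energy T \<nu> \<mu> + Q \<nu> = ennreal K"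
    if "prob_space \<nu>" and [measurable_cong, simp]: "sets \<nu> = sets borel" and "AE x in \<nu>. \<bar>x\<bar> \<le> r" for \<nu>
  proof -
    interpret \<nu>: prob_space \<nu> by fact
    have "log_energy T \<nu> \<mu> + Q \<nu> = (\<integral>\<^sup>+x. (\<integral>\<^sup>+y. log_kernel T x y \<partial>\<mu>) + ennreal (ln (max 1 \<bar>x\<bar>)) \<partial>\<nu>)"
      unfolding log_energy_def Q_def by (rule nn_integral_add[symmetric]) measurable
    also have "\<dots> = (\<integral>\<^sup>+x. ennreal K \<partial>\<nu>)"
      using that(3) by (intro nn_integral_cong_AE, eventually_elim) (simp add: pot)
    finally show ?thesis by (simp add: \<nu>.emeasure_space_1)
  qed
  have \<mu>K: "log_energy T \<mu> \<mu> + Q \<mu> = ennreal K"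
    by (rule mixed) (use assms in auto)
  then have fin: "log_energy T \<mu> \<mu> \<noteq> \<top>" "Q \<mu> \<noteq> \<top>"
    by (auto simp: add_top)
  have f\<mu>: "field_energy T \<mu> = ennreal K + Q \<mu>"
    unfolding field_energy_def Q_def[symmetric] \<mu>K[symmetric] by (simp add: mult_2 add.assoc)
  then show "field_energy T \<mu> = ennreal K + (\<integral>\<^sup>+x. ennreal (ln (max 1 \<bar>x\<bar>)) \<partial>\<mu>)"
    by (simp add: Q_def)
  have main: "field_energy T \<nu> = field_energy T \<mu> + window_defect T \<nu> \<mu>"
    if \<nu>: "prob_space \<nu>" "sets \<nu> = sets borel" "AE x in \<nu>. \<bar>x\<bar> \<le> r" for \<nu>
  proof -
    \<comment> \<open>The energy of \<open>\<mu>\<close> is added to both sides to avoid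
      subtraction; being finite, it can be cancelled at the end.\<close>
    have "log_energy T \<mu> \<mu> + field_energy T \<nu> = (log_energy T \<nu> \<nu> + log_energy T \<mu> \<mu>) + 2 * Q \<nu>"
      unfolding field_energy_def Q_def[symmetric] by (simp add: add_ac)
    also have "\<dots> = 2 * (log_energy T \<nu> \<mu> + Q \<nu>) + window_defect T \<nu> \<mu>"
      using log_energy_polarization[OF \<nu>(1) assms(1) \<nu>(2) assms(2) \<nu>(3) supp T]
      by (simp add: distrib_left add_ac)
    also have "\<dots> = 2 * (log_energy T \<mu> \<mu> + Q \<mu>) + window_defect T \<nu> \<mu>"
      unfolding mixed[OF \<nu>] \<mu>K ..
    also have "\<dots> = log_energy T \<mu> \<mu> + (field_energy T \<mu> + window_defect T \<nu> \<mu>)"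
      unfolding field_energy_def Q_def[symmetric] by (simp add: mult_2 distrib_left add_ac)
    finally show ?thesis
      using fin by (simp add: ennreal_add_left_cancel)
  qed
  show "field_energy T \<mu> \<le> field_energy T \<nu>"
    if \<nu>: "prob_space \<nu>" "sets \<nu> = sets borel" "AE x in \<nu>. \<bar>x\<bar> \<le> r" for \<nu>
    unfolding main[OF \<nu>] by simp
  show "\<nu> = \<mu>"
    if \<nu>: "prob_space \<nu>" "sets \<nu> = sets borel" "AE x in \<nu>. \<bar>x\<bar> \<le> r" "field_energy T \<nu> = field_energy T \<mu>" for \<nu>
  proof -
    have "field_energy T \<mu> + window_defect T \<nu> \<mu> = field_energy T \<mu> + 0"
      using main[OF \<nu>(1-3)] \<nu>(4) by simp
    moreover have "field_energy T \<mu> \<noteq> \<top>" using fin by (simp add: f\<mu>)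
    ultimately have "window_defect T \<nu> \<mu> = 0"
      by (simp only: ennreal_add_left_cancel) simp
    then show ?thesis
      by (intro window_defect_eq_0[OF \<nu>(1) assms(1) \<nu>(2) assms(2) \<nu>(3) supp T])
  qed
qed

section \<open>The potential of the equilibrium law\<close>

lemma log_potential_measurable [measurable]: "log_potential \<in> borel_measurable borel"
  unfolding log_potential_def by measurable

lemma
  assumes "\<bar>c\<bar> + 1 \<le> T"
  shows nn_integral_ln_cos_diff:
      "(\<integral>\<^sup>+t. ennreal (ln T - ln \<bar>c - cos t\<bar>) \<partial>angle_measure) = ennreal (ln T - log_potential c)"
    and log_potential_le: "log_potential c \<le> ln T"
proof -
  have le: "ln \<bar>c - cos t\<bar> \<le> ln T" for t
  proof (cases "c = cos t")
    case False
    have "\<bar>c - cos t\<bar> \<le> T" using abs_cos_le_one[of t] assms by linarith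
    then show ?thesis using False by simp
  qed (use assms in auto)
  have i: "integrable angle_measure (\<lambda>t. ln T - ln \<bar>c - cos t\<bar>)"
    using integrable_ln_cos_diff by auto
  have I: "(\<integral>t. ln T - ln \<bar>c - cos t\<bar> \<partial>angle_measure) = ln T - log_potential c"
    using integrable_ln_cos_diff by (simp add: log_potential_def angle.prob_space)
  show "(\<integral>\<^sup>+t. ennreal (ln T - ln \<bar>c - cos t\<bar>) \<partial>angle_measure) = ennreal (ln T - log_potential c)"
    unfolding I[symmetric] using le by (intro nn_integral_eq_integral i) auto
  have "0 \<le> (\<integral>t. ln T - ln \<bar>c - cos t\<bar> \<partial>angle_measure)"
    using le by (intro integral_nonneg_AE) auto
  then show "log_potential c \<le> ln T" unfolding I by simp
qed

text \<open>By Fubini, averaging over the other angle first, where the potential is known.\<close>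

lemma has_bochner_integral_log_potential_cos:
  "has_bochner_integral angle_measure (\<lambda>s. log_potential (x * cos s)) (ln (max 1 \<bar>x\<bar>) - ln 2)"
proof (cases "\<bar>x\<bar> \<le> 1")
  case True
  have "\<bar>x * cos s\<bar> \<le> 1" for s
    using mult_mono[OF True abs_cos_le_one[of s]] by (simp add: abs_mult)
  then have "(\<lambda>s. log_potential (x * cos s)) = (\<lambda>s. - ln 2)"
    by (simp add: log_potential_eq)
  moreover have "has_bochner_integral angle_measure (\<lambda>s. - ln 2) (- ln (2::real))"
    by (simp add: has_bochner_integral_iff angle.prob_space)
  ultimately show ?thesis using True by simp
next
  case False
  then have x: "\<bar>x\<bar> > 1" by simp
  define T where "T = \<bar>x\<bar> + 1"
  have T: "ln (T / \<bar>x\<bar>) \<ge> 0" using x by (auto simp: T_def)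
  have bound: "\<bar>x * cos s\<bar> + 1 \<le> T" for s
    using mult_left_mono[OF abs_cos_le_one[of s], of "\<bar>x\<bar>"] by (simp add: T_def abs_mult)
  have "(\<integral>\<^sup>+s. ennreal (ln T - log_potential (x * cos s)) \<partial>angle_measure) =
     (\<integral>\<^sup>+s. \<integral>\<^sup>+t. ennreal (ln T - ln \<bar>x * cos s - cos t\<bar>) \<partial>angle_measure \<partial>angle_measure)"
    by (simp only: nn_integral_ln_cos_diff[OF bound])
  also have "\<dots> = (\<integral>\<^sup>+t. \<integral>\<^sup>+s. ennreal (ln T - ln \<bar>x * cos s - cos t\<bar>) \<partial>angle_measure \<partial>angle_measure)"
    by (rule angle_pair.Fubini'[symmetric]) measurable
  \<comment> \<open>With \<open>\<bar>x\<bar>\<close> factored out, the inner integral over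
    \<open>s\<close> is a potential at \<open>cos t / x\<close>, which lies in
    \<open>[-1, 1]\<close> since \<open>\<bar>x\<bar> > 1\<close>; hence it does not depend on
    \<open>t\<close>.\<close>
  also have "\<dots> = (\<integral>\<^sup>+t. ennreal (ln (T / \<bar>x\<bar>) + ln 2) \<partial>angle_measure)"
  proof (intro nn_integral_cong)
    fix t
    have c: "\<bar>cos t / x\<bar> \<le> 1" "\<bar>cos t / x\<bar> + 1 \<le> T / \<bar>x\<bar>"
    proof -
      have "\<bar>cos t / x\<bar> \<le> 1 / \<bar>x\<bar>" unfolding abs_divide by (intro divide_right_mono) auto
      moreover have "1 / \<bar>x\<bar> \<le> 1" "T / \<bar>x\<bar> = 1 + 1 / \<bar>x\<bar>" using x by (auto simp: T_def field_simps)
      ultimately show "\<bar>cos t / x\<bar> \<le> 1" "\<bar>cos t / x\<bar> + 1 \<le> T / \<bar>x\<bar>" by linarith+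
    qed
    have "(\<integral>\<^sup>+s. ennreal (ln T - ln \<bar>x * cos s - cos t\<bar>) \<partial>angle_measure) =
      (\<integral>\<^sup>+s. ennreal (ln (T / \<bar>x\<bar>) - ln \<bar>cos t / x - cos s\<bar>) \<partial>angle_measure)"
    proof (intro nn_integral_cong_AE, use AE_angle_measure_cos_neq[of "cos t / x"] in eventually_elim)
      case (elim s)
      have "\<bar>x * cos s - cos t\<bar> = \<bar>x\<bar> * \<bar>cos t / x - cos s\<bar>"
        unfolding abs_mult[symmetric] using x by (subst abs_minus_commute) (auto simp: algebra_simps)
      then have "ln \<bar>x * cos s - cos t\<bar> = ln \<bar>x\<bar> + ln \<bar>cos t / x - cos s\<bar>"
        using x elim by (simp add: ln_mult)
      then show ?case using x by (simp add: ln_div T_def diff_diff_eq)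
    qed
    also have "\<dots> = ennreal (ln (T / \<bar>x\<bar>) + ln 2)"
      using c by (simp add: nn_integral_ln_cos_diff log_potential_eq)
    finally show "(\<integral>\<^sup>+s. ennreal (ln T - ln \<bar>x * cos s - cos t\<bar>) \<partial>angle_measure) = \<dots>" .
  qed
  also have "\<dots> = ennreal (ln (T / \<bar>x\<bar>) + ln 2)"
    using angle.emeasure_space_1 by simp
  finally have "has_bochner_integral angle_measure (\<lambda>s. ln T - log_potential (x * cos s)) (ln (T / \<bar>x\<bar>) + ln 2)"
    using T log_potential_le[OF bound] by (intro has_bochner_integral_nn_integral) auto
  then have "has_bochner_integral angle_measure (\<lambda>s. ln T - (ln T - log_potential (x * cos s)))
      (ln T - (ln (T / \<bar>x\<bar>) + ln 2))"
    by (intro has_bochner_integral_diff) (auto simp: has_bochner_integral_iff angle.prob_space)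
  moreover have "ln T - (ln (T / \<bar>x\<bar>) + ln 2) = ln (max 1 \<bar>x\<bar>) - ln 2"
    using x by (auto simp: ln_div T_def max_def)
  ultimately show ?thesis by simp
qed

lemma has_bochner_integral_ln_cos:
  "has_bochner_integral angle_measure (\<lambda>s. ln \<bar>cos s\<bar>) (- ln 2)"
  using integrable_ln_cos_diff[of 0] log_potential_eq[of 0]
  by (simp add: has_bochner_integral_iff log_potential_def)

text \<open>Equal to \<open>min r (1 / \<bar>cos s\<bar>)\<close> when \<open>r > 0\<close> and
  \<open>cos s \<noteq> 0\<close>. The form with \<open>max\<close> gives the right value
  \<open>r\<close> at \<open>cos s = 0\<close>, where \<open>1 / 0 = 0\<close> would spoil the
  minimum.\<close>

definition truncated_sec :: "real \<Rightarrow> real \<Rightarrow> real" where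
  "truncated_sec r s = 1 / max \<bar>cos s\<bar> (1 / r)"

definition equilibrium_law :: "real \<Rightarrow> real measure" where
  "equilibrium_law r =
     distr (angle_measure \<Otimes>\<^sub>M angle_measure) borel (\<lambda>(s, t). truncated_sec r s * cos t)"

text \<open>The additive cost of truncation: the mean of the positive part of
  \<open>ln (1 / (r * \<bar>cos s\<bar>))\<close>.\<close>

definition robin_shift :: "real \<Rightarrow> real" where
  "robin_shift r = (\<integral>s. max 0 (- ln (r * \<bar>cos s\<bar>)) \<partial>angle_measure)"

lemma truncated_sec_measurable [measurable]: "truncated_sec r \<in> borel_measurable borel"
  unfolding truncated_sec_def by measurable

lemma truncated_sec_bounds:
  assumes "r > 0"
  shows "0 < truncated_sec r s" "truncated_sec r s \<le> r"
proof -
  have m: "0 < max \<bar>cos s\<bar> (1 / r)" "1 / r \<le> max \<bar>cos s\<bar> (1 / r)"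
    using assms by (auto simp: less_max_iff_disj)
  then show "0 < truncated_sec r s" by (simp add: truncated_sec_def)
  show "truncated_sec r s \<le> r"
    using divide_left_mono[OF m(2), of 1] m assms by (simp add: truncated_sec_def)
qed

lemma truncated_sec_eq:
  assumes "r > 0"
  shows "r * \<bar>cos s\<bar> \<le> 1 \<Longrightarrow> truncated_sec r s = r"
    and "1 \<le> r * \<bar>cos s\<bar> \<Longrightarrow> truncated_sec r s = 1 / \<bar>cos s\<bar>"
  using assms by (auto simp: truncated_sec_def max_def field_simps)

lemma sets_equilibrium_law [simp, measurable_cong]: "sets (equilibrium_law r) = sets borel"
  by (simp add: equilibrium_law_def)

lemma space_equilibrium_law [simp]: "space (equilibrium_law r) = UNIV"
  by (simp add: equilibrium_law_def)

lemma prob_space_equilibrium_law: "prob_space (equilibrium_law r)"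
  unfolding equilibrium_law_def by (rule angle_pair.prob_space_distr) measurable

lemma nn_integral_equilibrium_law:
  assumes [measurable]: "h \<in> borel_measurable borel"
  shows "(\<integral>\<^sup>+y. h y \<partial>equilibrium_law r) =
    (\<integral>\<^sup>+s. \<integral>\<^sup>+t. h (truncated_sec r s * cos t) \<partial>angle_measure \<partial>angle_measure)"
  unfolding equilibrium_law_def
  by (subst nn_integral_distr)
     (auto simp: angle.nn_integral_fst[symmetric] case_prod_beta)

lemma AE_equilibrium_law:
  assumes "r > 0"
  shows "AE x in equilibrium_law r. \<bar>x\<bar> \<le> r"
proof -
  have "\<bar>truncated_sec r s * cos t\<bar> \<le> r" for s t
    using truncated_sec_bounds[OF assms, of s] mult_mono[OF truncated_sec_bounds(2)[OF assms] abs_cos_le_one[of t], of s]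
      assms by (simp add: abs_mult)
  then show ?thesis
    unfolding equilibrium_law_def by (subst AE_distr_iff) auto
qed

lemma integrable_robin_shift:
  assumes "r > 0"
  shows "integrable angle_measure (\<lambda>s. max 0 (- ln (r * \<bar>cos s\<bar>)))"
proof -
  have "AE s in angle_measure. ln (r * \<bar>cos s\<bar>) = ln r + ln \<bar>cos s\<bar>"
    using AE_angle_measure_cos_neq[of 0] by eventually_elim (use assms in \<open>simp add: ln_mult\<close>)
  moreover have "integrable angle_measure (\<lambda>s. ln r + ln \<bar>cos s\<bar>)"
    using has_bochner_integral_ln_cos by (auto simp: has_bochner_integral_iff)
  ultimately have "integrable angle_measure (\<lambda>s. ln (r * \<bar>cos s\<bar>))"
    by (subst integrable_cong_AE) auto
  then show ?thesis by auto
qed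

text \<open>Rescaling by the radius \<open>u\<close> gives
  \<open>ln (T / u) - log_potential (x / u)\<close>. If the radius is truncated,
  \<open>x / u\<close> and \<open>x * cos s\<close> both lie in \<open>[-1, 1]\<close> and have the
  same potential; if not, they agree up to sign. So \<Phi> may contain
  \<open>log_potential (x * cos s)\<close> in both cases, with the truncation visible only in its
  last term.\<close>

lemma nn_integral_log_kernel_truncated_sec:
  assumes "r > 0" "\<bar>x\<bar> \<le> r" "2 * r \<le> T" "cos s \<noteq> 0"
  defines "\<Phi> \<equiv> ln T - log_potential (x * cos s) + ln \<bar>cos s\<bar> + max 0 (- ln (r * \<bar>cos s\<bar>))"
  shows "(\<integral>\<^sup>+t. log_kernel T x (truncated_sec r s * cos t) \<partial>angle_measure) = ennreal \<Phi>" "0 \<le> \<Phi>"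
proof -
  define u where "u = truncated_sec r s"
  have u: "0 < u" "u \<le> r" using truncated_sec_bounds assms by (auto simp: u_def)
  have T: "T > 0" using assms by linarith
  have b: "\<bar>x / u\<bar> + 1 \<le> T / u"
  proof -
    have "(\<bar>x\<bar> + u) / u \<le> T / u" using u assms(2,3) by (intro divide_right_mono) auto
    then show ?thesis using u by (simp add: add_divide_distrib abs_divide)
  qed
  have \<Phi>: "\<Phi> = ln (T / u) - log_potential (x / u)"
  proof (cases "r * \<bar>cos s\<bar> \<le> 1")
    case True
    then have ur: "u = r" using truncated_sec_eq assms by (simp add: u_def)
    have "\<bar>x * cos s\<bar> \<le> r * \<bar>cos s\<bar>"
      using assms by (simp add: abs_mult mult_right_mono)
    with True have "log_potential (x * cos s) = - ln 2" by (intro log_potential_eq) linarith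
    moreover have "log_potential (x / u) = - ln 2"
      using assms by (intro log_potential_eq) (simp add: ur)
    moreover have "ln (r * \<bar>cos s\<bar>) \<le> 0" using True assms by (subst ln_le_zero_iff) auto
    ultimately show ?thesis
      using assms T by (simp add: \<Phi>_def ur ln_div ln_mult)
  next
    case False
    then have uc: "u = 1 / \<bar>cos s\<bar>" using truncated_sec_eq assms by (simp add: u_def)
    have "log_potential (x / u) = log_potential (x * cos s)"
      using log_potential_uminus[of "x * cos s"] by (cases "cos s \<ge> 0") (auto simp: uc)
    moreover have "ln (r * \<bar>cos s\<bar>) \<ge> 0" using False by (intro ln_ge_zero) auto
    ultimately show ?thesis
      using assms T by (simp add: \<Phi>_def uc ln_mult)
  qed
  then show "0 \<le> \<Phi>" using log_potential_le[OF b] by simp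
  have "(\<integral>\<^sup>+t. log_kernel T x (u * cos t) \<partial>angle_measure) =
      (\<integral>\<^sup>+t. ennreal (ln (T / u) - ln \<bar>x / u - cos t\<bar>) \<partial>angle_measure)"
  proof (intro nn_integral_cong_AE, use AE_angle_measure_cos_neq[of "x / u"] in eventually_elim)
    case (elim t)
    have "\<bar>x - u * cos t\<bar> = u * \<bar>x / u - cos t\<bar>"
      using u by (simp add: abs_if field_simps)
    moreover have "x \<noteq> u * cos t" using elim u by (auto simp: field_simps)
    ultimately show ?case using elim u T
      by (simp add: log_kernel_def ln_div ln_mult diff_diff_eq)
  qed
  also have "\<dots> = ennreal \<Phi>"
    unfolding \<Phi> by (rule nn_integral_ln_cos_diff[OF b])
  finally show "(\<integral>\<^sup>+t. log_kernel T x (truncated_sec r s * cos t) \<partial>angle_measure) = ennreal \<Phi>"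
    by (simp add: u_def)
qed

lemma equilibrium_law_potential:
  assumes "r > 0" "\<bar>x\<bar> \<le> r" "2 * r \<le> T"
  shows "(\<integral>\<^sup>+y. log_kernel T x y \<partial>equilibrium_law r) = ennreal (ln T + robin_shift r - ln (max 1 \<bar>x\<bar>))"
    and "0 \<le> ln T + robin_shift r - ln (max 1 \<bar>x\<bar>)"
proof -
  define \<Phi> where "\<Phi> s = ln T - log_potential (x * cos s) + ln \<bar>cos s\<bar> + max 0 (- ln (r * \<bar>cos s\<bar>))" for s
  \<comment> \<open>The \<open>ln 2\<close> from the averaged potential and the
    \<open>- ln 2\<close> from the mean of \<open>ln \<bar>cos s\<bar>\<close> cancel.\<close>
  have \<Phi>: "has_bochner_integral angle_measure \<Phi>
     (ln T - (ln (max 1 \<bar>x\<bar>) - ln 2) + - ln 2 + robin_shift r)"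
    unfolding \<Phi>_def
    by (intro has_bochner_integral_add has_bochner_integral_diff has_bochner_integral_log_potential_cos
        has_bochner_integral_ln_cos)
       (auto simp: has_bochner_integral_iff angle.prob_space robin_shift_def integrable_robin_shift assms)
  have nn: "AE s in angle_measure. 0 \<le> \<Phi> s"
    using AE_angle_measure_cos_neq[of 0]
    by eventually_elim (use nn_integral_log_kernel_truncated_sec(2)[OF assms] in \<open>simp add: \<Phi>_def\<close>)
  have "(\<integral>\<^sup>+y. log_kernel T x y \<partial>equilibrium_law r) = (\<integral>\<^sup>+s. ennreal (\<Phi> s) \<partial>angle_measure)"
    unfolding \<Phi>_def using AE_angle_measure_cos_neq[of 0]
    by (subst nn_integral_equilibrium_law, simp, intro nn_integral_cong_AE, eventually_elim)
       (use nn_integral_log_kernel_truncated_sec(1)[OF assms] in simp)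
  also have "\<dots> = ennreal (\<integral>s. \<Phi> s \<partial>angle_measure)"
    using \<Phi> nn by (intro nn_integral_eq_integral) (auto simp: has_bochner_integral_iff)
  also have "(\<integral>s. \<Phi> s \<partial>angle_measure) = ln T + robin_shift r - ln (max 1 \<bar>x\<bar>)"
    using \<Phi> by (simp add: has_bochner_integral_iff)
  finally show "(\<integral>\<^sup>+y. log_kernel T x y \<partial>equilibrium_law r) = ennreal (ln T + robin_shift r - ln (max 1 \<bar>x\<bar>))" .
  have "0 \<le> (\<integral>s. \<Phi> s \<partial>angle_measure)" using nn by (rule integral_nonneg_AE)
  then show "0 \<le> ln T + robin_shift r - ln (max 1 \<bar>x\<bar>)"
    using \<Phi> by (simp add: has_bochner_integral_iff)
qed

text \<open>The positive and negative parts of \<open>ln (r * \<bar>cos s\<bar>)\<close> differ by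
  the function itself, whose mean is \<open>ln r - ln 2\<close>. This moves the integral to the
  region \<open>r * \<bar>cos s\<bar> \<ge> 1\<close>, where the stated formula has it.\<close>

lemma robin_shift_eq:
  assumes "r > 0"
  shows "robin_shift r = ln (2 / r) + (\<integral>s. max 0 (ln (r * \<bar>cos s\<bar>)) \<partial>angle_measure)"
    and "integrable angle_measure (\<lambda>s. max 0 (ln (r * \<bar>cos s\<bar>)))"
proof -
  have m: "max 0 (ln (r * \<bar>cos s\<bar>)) = max 0 (- ln (r * \<bar>cos s\<bar>)) + ln (r * \<bar>cos s\<bar>)" for s
    by (auto simp: max_def)
  have "AE s in angle_measure. ln (r * \<bar>cos s\<bar>) = ln r + ln \<bar>cos s\<bar>"
    using AE_angle_measure_cos_neq[of 0] by eventually_elim (use assms in \<open>simp add: ln_mult\<close>)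
  moreover have "has_bochner_integral angle_measure (\<lambda>s. ln r + ln \<bar>cos s\<bar>) (ln r + - ln 2)"
    by (intro has_bochner_integral_add has_bochner_integral_ln_cos)
       (simp add: has_bochner_integral_iff angle.prob_space)
  ultimately have "has_bochner_integral angle_measure (\<lambda>s. ln (r * \<bar>cos s\<bar>)) (ln r + - ln 2)"
    by (subst has_bochner_integral_cong_AE) auto
  then have "has_bochner_integral angle_measure (\<lambda>s. max 0 (ln (r * \<bar>cos s\<bar>))) (robin_shift r + (ln r + - ln 2))"
    unfolding m by (intro has_bochner_integral_add)
      (auto simp: has_bochner_integral_iff robin_shift_def integrable_robin_shift assms)
  then show "robin_shift r = ln (2 / r) + (\<integral>s. max 0 (ln (r * \<bar>cos s\<bar>)) \<partial>angle_measure)"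
    "integrable angle_measure (\<lambda>s. max 0 (ln (r * \<bar>cos s\<bar>)))"
    using assms by (auto simp: has_bochner_integral_iff ln_div)
qed

section \<open>Transfer to the projective line\<close>

lemma not_range_of_affine: "p \<notin> range of_affine \<Longrightarrow> affine_coord p = 0"
proof -
  have "affine_coord p \<noteq> 0 \<Longrightarrow> p = of_affine (affine_coord p)"
  proof transfer
    fix p :: "real \<times> real"
    assume "proj_rel p p" "fst p / snd p \<noteq> 0"
    then show "proj_rel p (fst p / snd p, 1)"
      by (cases p) (auto simp: proj_rel_def intro!: exI[of _ "1 / snd p"])
  qed
  then show "p \<notin> range of_affine \<Longrightarrow> affine_coord p = 0" by blast
qed

lemma inj_of_affine: "inj of_affine"
  by (metis affine_coord_of_affine injI)

lemma of_affine_Icc_borel [measurable]: "of_affine ` {a..b} \<in> sets borel"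
  by (intro borel_compact compact_continuous_image continuous_on_of_affine compact_Icc)

text \<open>A sublevel set is the image of a half-line, a countable union of compact sets, together
  with the point at infinity when \<open>0 \<le> a\<close>, because that point has coordinate 0 by
  default.\<close>

lemma affine_coord_measurable [measurable]: "affine_coord \<in> borel_measurable borel"
proof (rule borel_measurableI_le)
  fix a :: real
  have UNIV: "(UNIV :: real set) = (\<Union>n. {- real n..real n})"
  proof -
    have "\<exists>n. - real n \<le> x \<and> x \<le> real n" for x :: real
      using real_arch_simple[of "\<bar>x\<bar>"] by (metis abs_le_iff minus_le_iff)
    then show ?thesis by auto
  qed
  have range: "range of_affine \<in> sets borel"
    unfolding UNIV image_UN by (rule sets.countable_UN) auto
  have "{..a} = (\<Union>n. {- real n..a})"
  proof -
    have "\<exists>n. - x \<le> real n" for x :: real by (rule real_arch_simple)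
    then show ?thesis by (auto simp: minus_le_iff)
  qed
  then have le: "of_affine ` {..a} \<in> sets borel"
    by (simp only: image_UN) (rule sets.countable_UN, auto)
  have "{w \<in> space borel. affine_coord w \<le> a} =
      of_affine ` {..a} \<union> (if 0 \<le> a then - range of_affine else {})"
  proof (rule set_eqI)
    fix p
    show "p \<in> {w \<in> space borel. affine_coord w \<le> a} \<longleftrightarrow>
        p \<in> of_affine ` {..a} \<union> (if 0 \<le> a then - range of_affine else {})"
    proof (cases "p \<in> range of_affine")
      case True
      then obtain x where "p = of_affine x" by blast
      then show ?thesis by (simp add: inj_image_mem_iff[OF inj_of_affine])
    next
      case False
      then show ?thesis using not_range_of_affine[OF False] by auto
    qed
  qed
  also have "\<dots> \<in> sets borel" using le range by auto
  finally show "{w \<in> space borel. affine_coord w \<le> a} \<in> sets borel" .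
qed

text \<open>The positive and negative parts of \<open>g - C\<close> are the truncated differences of
  \<open>g\<close> and \<open>C\<close> in the two orders. The negative part has integral at most
  \<open>C\<close>, so the difference of the two integrals is never
  \<open>\<infinity> - \<infinity>\<close>.\<close>

lemma ereal_integral_shift:
  assumes "prob_space M" and [measurable]: "g \<in> borel_measurable M" and C: "C \<ge> 0"
    and f: "AE x in M. f x = enn2ereal (g x) - ereal C"
  shows "ereal_integral M f = enn2ereal (\<integral>\<^sup>+x. g x \<partial>M) - ereal C"
proof -
  interpret prob_space M by fact
  have pos: "e2ennreal (enn2ereal z - ereal C) = z - ennreal C"
    and neg: "e2ennreal (- (enn2ereal z - ereal C)) = ennreal C - z" for z
  proof -
    have e: "enn2ereal (ennreal C) = ereal C" using C by simp
    show "e2ennreal (enn2ereal z - ereal C) = z - ennreal C"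
      unfolding e[symmetric] by (rule e2eenreal_enn2ereal_diff)
    have "- (enn2ereal z - ereal C) = ereal C - enn2ereal z"
      by (cases "enn2ereal z") simp_all
    then show "e2ennreal (- (enn2ereal z - ereal C)) = ennreal C - z"
      unfolding e[symmetric] by (simp only: e2eenreal_enn2ereal_diff)
  qed
  have P: "(\<integral>\<^sup>+x. e2ennreal (f x) \<partial>M) = (\<integral>\<^sup>+x. g x - ennreal C \<partial>M)"
    and N: "(\<integral>\<^sup>+x. e2ennreal (- f x) \<partial>M) = (\<integral>\<^sup>+x. ennreal C - g x \<partial>M)"
    using f by (auto intro!: nn_integral_cong_AE simp: pos neg elim!: eventually_mono)
  have "(\<integral>\<^sup>+x. ennreal C - g x \<partial>M) \<le> (\<integral>\<^sup>+x. ennreal C \<partial>M)"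
    by (intro nn_integral_mono) (simp add: diff_le_self_ennreal)
  also have "\<dots> = ennreal C" by (simp add: emeasure_space_1)
  finally have fin: "(\<integral>\<^sup>+x. ennreal C - g x \<partial>M) \<le> ennreal C" .
  \<comment> \<open>Both sides are the maximum of \<open>z\<close> and \<open>C\<close>, since
    subtraction in \<open>ennreal\<close> truncates at zero.\<close>
  have "(z - ennreal C) + ennreal C = z + (ennreal C - z)" for z
    using C by (cases z; cases "z \<le> ennreal C")
      (auto simp: ennreal_minus ennreal_neg simp flip: ennreal_plus)
  then have "(\<integral>\<^sup>+x. (g x - ennreal C) + ennreal C \<partial>M) = (\<integral>\<^sup>+x. g x + (ennreal C - g x) \<partial>M)"
    by simp
  then have "(\<integral>\<^sup>+x. g x - ennreal C \<partial>M) + ennreal C = (\<integral>\<^sup>+x. g x \<partial>M) + (\<integral>\<^sup>+x. ennreal C - g x \<partial>M)"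
    by (simp add: nn_integral_add emeasure_space_1)
  then show ?thesis
    unfolding ereal_integral_def P N using fin C
    by (cases "\<integral>\<^sup>+x. g x - ennreal C \<partial>M"; cases "\<integral>\<^sup>+x. ennreal C - g x \<partial>M"; cases "\<integral>\<^sup>+x. g x \<partial>M")
      (auto simp: top_unique simp flip: ennreal_plus)
qed

section \<open>The spherical energy as a weighted logarithmic energy on the line\<close>

definition shifted_kernel :: "real \<Rightarrow> real \<Rightarrow> real \<Rightarrow> ennreal" where
  "shifted_kernel T x y = log_kernel T x y + (ennreal (ln (max 1 \<bar>x\<bar>)) + ennreal (ln (max 1 \<bar>y\<bar>)))"

lemma shifted_kernel_measurable [measurable]:
  "case_prod (shifted_kernel T) \<in> borel_measurable (borel \<Otimes>\<^sub>M borel)"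
  unfolding shifted_kernel_def by measurable

lemma neg_log_dist_of_affine:
  assumes "\<bar>x - y\<bar> \<le> T"
  shows "neg_log_dist (of_affine x) (of_affine y) = enn2ereal (shifted_kernel T x y) - ereal (ln T)"
proof (cases "x = y")
  case False
  then have T: "T > 0" "0 < \<bar>x - y\<bar>" using assms by linarith+
  define a where "a = max 1 \<bar>x\<bar>"
  define b where "b = max 1 \<bar>y\<bar>"
  have ab: "a \<ge> 1" "b \<ge> 1" by (auto simp: a_def b_def)
  have nn: "0 \<le> ln (T / \<bar>x - y\<bar>)" "0 \<le> ln a" "0 \<le> ln b" using T assms ab by auto
  have "shifted_kernel T x y = ennreal (ln (T / \<bar>x - y\<bar>) + (ln a + ln b))"
    using False nn by (simp add: shifted_kernel_def log_kernel_def a_def b_def)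
  then have "enn2ereal (shifted_kernel T x y) = ereal (ln (T / \<bar>x - y\<bar>) + (ln a + ln b))"
    using nn by (simp only: enn2ereal_ennreal add_nonneg_nonneg)
  moreover have "neg_log_dist (of_affine x) (of_affine y) = ereal (- ln (\<bar>x - y\<bar> / (a * b)))"
    using False by (simp add: neg_log_dist_def inj_eq[OF inj_of_affine] dist_of_affine a_def b_def)
  moreover have "ln (T / \<bar>x - y\<bar>) = ln T - ln \<bar>x - y\<bar>" using T by (simp add: ln_div)
  moreover have "ln (\<bar>x - y\<bar> / (a * b)) = ln \<bar>x - y\<bar> - (ln a + ln b)"
  proof -
    have "a \<noteq> 0" "b \<noteq> 0" "\<bar>x - y\<bar> \<noteq> 0" using T ab by linarith+
    then show ?thesis by (simp add: ln_div ln_mult del: abs_eq_0)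
  qed
  ultimately show ?thesis
    by (simp only: ereal_minus) simp
qed (simp add: neg_log_dist_def shifted_kernel_def log_kernel_def)

lemma log_kernel_commute: "log_kernel T x y = log_kernel T y x"
  by (simp add: log_kernel_def abs_minus_commute)

context
  fixes r T :: real and \<nu> :: "p1 measure"
  assumes r: "r > 0" and T: "1 \<le> T" "2 * r \<le> T"
    and \<nu>: "\<nu> \<in> prob_measures_on (affine_interval r)"
begin

lemma prob_measures_on_facts:
  shows "prob_space \<nu>" and sets_prob_measures_on: "sets \<nu> = sets borel"
    and AE_prob_measures_on: "AE p in \<nu>. \<bar>affine_coord p\<bar> \<le> r \<and> of_affine (affine_coord p) = p"
proof -
  show "prob_space \<nu>" and [simp]: "sets \<nu> = sets borel"
    using \<nu> by (auto simp: prob_measures_on_def)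
  have E: "affine_interval r \<in> sets borel"
    by (intro borel_compact compact_affine_interval)
  have "AE p in \<nu>. p \<in> affine_interval r"
    by (rule AE_I[where N = "- affine_interval r"])
       (use \<nu> E in \<open>auto simp: prob_measures_on_def borel_comp\<close>)
  then show "AE p in \<nu>. \<bar>affine_coord p\<bar> \<le> r \<and> of_affine (affine_coord p) = p"
    by eventually_elim (auto simp: affine_interval_def abs_le_iff)
qed

lemma coord_distr_facts:
  shows "prob_space (distr \<nu> borel affine_coord)"
    and "AE x in distr \<nu> borel affine_coord. \<bar>x\<bar> \<le> r"
    and distr_coord_distr: "distr (distr \<nu> borel affine_coord) borel of_affine = \<nu>"
proof -
  note [measurable_cong] = sets_prob_measures_on
  interpret prob_space \<nu> by (rule prob_measures_on_facts)
  show "prob_space (distr \<nu> borel affine_coord)" by (rule prob_space_distr) measurable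
  show "AE x in distr \<nu> borel affine_coord. \<bar>x\<bar> \<le> r"
    using AE_prob_measures_on by (subst AE_distr_iff) (auto elim: eventually_mono)
  have "distr (distr \<nu> borel affine_coord) borel of_affine = distr \<nu> borel (of_affine \<circ> affine_coord)"
    by (rule distr_distr) measurable
  also have "\<dots> = distr \<nu> \<nu> (\<lambda>p. p)"
    using AE_prob_measures_on by (intro distr_cong_AE) (auto simp: sets_prob_measures_on elim: eventually_mono)
  finally show "distr (distr \<nu> borel affine_coord) borel of_affine = \<nu>"
    by simp
qed

text \<open>The shift by \<open>ln T\<close> is extracted from the inner and then from the outer
  integral; it survives once because \<nu> has mass 1. The assumption \<open>1 \<le> T\<close>
  supplies the nonnegative constant that the shift rule asks for.\<close>

lemma delta_energy_eq_field_energy: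
  "delta_energy \<nu> = enn2ereal (field_energy T (distr \<nu> borel affine_coord)) - ereal (ln T)"
proof -
  note [measurable_cong] = sets_prob_measures_on
  interpret prob_space \<nu> by (rule prob_measures_on_facts)
  define \<alpha> where "\<alpha> = distr \<nu> borel affine_coord"
  have [simp, measurable_cong]: "sets \<alpha> = sets borel" by (simp add: \<alpha>_def)
  interpret \<alpha>: prob_space \<alpha> unfolding \<alpha>_def by (rule coord_distr_facts)
  have lnT: "ln T \<ge> 0" using T by simp
  have ker: "neg_log_dist p q = enn2ereal (shifted_kernel T (affine_coord p) (affine_coord q)) - ereal (ln T)"
    if "\<bar>affine_coord p\<bar> \<le> r \<and> of_affine (affine_coord p) = p"
       "\<bar>affine_coord q\<bar> \<le> r \<and> of_affine (affine_coord q) = q" for p q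
  proof -
    have "\<bar>affine_coord p - affine_coord q\<bar> \<le> T" using that T by linarith
    from neg_log_dist_of_affine[OF this] show ?thesis using that by simp
  qed
  have inner: "ereal_integral \<nu> (\<lambda>p. neg_log_dist p q) =
      enn2ereal (\<integral>\<^sup>+p. shifted_kernel T (affine_coord p) (affine_coord q) \<partial>\<nu>) - ereal (ln T)"
    if q: "\<bar>affine_coord q\<bar> \<le> r \<and> of_affine (affine_coord q) = q" for q
  proof (rule ereal_integral_shift[OF prob_space_axioms _ lnT])
    show "AE p in \<nu>. neg_log_dist p q =
        enn2ereal (shifted_kernel T (affine_coord p) (affine_coord q)) - ereal (ln T)"
      using AE_prob_measures_on by eventually_elim (rule ker[OF _ q])
  qed measurable
  have "delta_energy \<nu> = enn2ereal (\<integral>\<^sup>+q. \<integral>\<^sup>+p. shifted_kernel T (affine_coord p) (affine_coord q) \<partial>\<nu> \<partial>\<nu>) - ereal (ln T)"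
    unfolding delta_energy_def
  proof (rule ereal_integral_shift[OF prob_space_axioms _ lnT])
    show "AE q in \<nu>. ereal_integral \<nu> (\<lambda>p. neg_log_dist p q) =
        enn2ereal (\<integral>\<^sup>+p. shifted_kernel T (affine_coord p) (affine_coord q) \<partial>\<nu>) - ereal (ln T)"
      using AE_prob_measures_on by eventually_elim (rule inner)
  qed measurable
  also have "(\<integral>\<^sup>+q. \<integral>\<^sup>+p. shifted_kernel T (affine_coord p) (affine_coord q) \<partial>\<nu> \<partial>\<nu>) =
      (\<integral>\<^sup>+y. \<integral>\<^sup>+x. shifted_kernel T x y \<partial>\<alpha> \<partial>\<alpha>)"
    unfolding \<alpha>_def by (simp add: nn_integral_distr)
  also have "\<dots> = field_energy T \<alpha>"
  proof -
    let ?Q = "\<integral>\<^sup>+x. ennreal (ln (max 1 \<bar>x\<bar>)) \<partial>\<alpha>"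
    have "(\<integral>\<^sup>+x. shifted_kernel T x y \<partial>\<alpha>) =
        (\<integral>\<^sup>+x. log_kernel T y x \<partial>\<alpha>) + (?Q + ennreal (ln (max 1 \<bar>y\<bar>)))" for y
      unfolding shifted_kernel_def log_kernel_commute[of T _ y]
      by (simp add: nn_integral_add \<alpha>.emeasure_space_1)
    then show ?thesis
      by (simp add: nn_integral_add \<alpha>.emeasure_space_1 field_energy_def log_energy_def mult_2)
  qed
  finally show ?thesis by (simp add: \<alpha>_def)
qed

end

lemma distr_of_affine_in_prob_measures_on:
  assumes "prob_space \<mu>" "sets \<mu> = sets borel" "AE x in \<mu>. \<bar>x\<bar> \<le> r"
  shows "distr \<mu> borel of_affine \<in> prob_measures_on (affine_interval r)"
    and "distr (distr \<mu> borel of_affine) borel affine_coord = \<mu>"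
proof -
  note [measurable_cong] = assms(2)
  interpret prob_space \<mu> by fact
  have E: "affine_interval r \<in> sets borel"
    by (intro borel_compact compact_affine_interval)
  have "AE x in \<mu>. of_affine x \<notin> - affine_interval r"
    using assms(3) by eventually_elim (auto simp: affine_interval_def abs_le_iff)
  from emeasure_eq_0_AE[OF this] have "emeasure \<mu> (of_affine -` (- affine_interval r) \<inter> space \<mu>) = 0"
    by (simp add: vimage_def Int_def conj_commute)
  then show "distr \<mu> borel of_affine \<in> prob_measures_on (affine_interval r)"
    using E by (auto simp: prob_measures_on_def emeasure_distr borel_comp intro!: prob_space_distr)
  have "distr (distr \<mu> borel of_affine) borel affine_coord = distr \<mu> borel (affine_coord \<circ> of_affine)"
    by (rule distr_distr) measurable
  also have "affine_coord \<circ> of_affine = (\<lambda>x. x)"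
    by (simp add: fun_eq_iff)
  also have "distr \<mu> borel (\<lambda>x. x) = \<mu>"
    by (rule distr_id2) (simp add: assms(2))
  finally show "distr (distr \<mu> borel of_affine) borel affine_coord = \<mu>" .
qed

text \<open>Push-forward along \<open>of_affine\<close> and along \<open>affine_coord\<close> are
  mutually inverse on probability measures carried by the interval, and they change the energy only
  by \<open>ln T\<close>. Minimality and uniqueness therefore carry over, and uniqueness resolves
  the definite description.\<close>

lemma delta_equilibrium_Frostman:
  assumes r: "r > 0" and T: "1 \<le> T" "2 * r \<le> T"
    and \<mu>: "prob_space \<mu>" "sets \<mu> = sets borel" "AE x in \<mu>. \<bar>x\<bar> \<le> r"
    and pot: "\<And>x. \<bar>x\<bar> \<le> r \<Longrightarrow> (\<integral>\<^sup>+y. log_kernel T x y \<partial>\<mu>) + ennreal (ln (max 1 \<bar>x\<bar>)) = ennreal K"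
  shows "delta_equilibrium (affine_interval r) = distr \<mu> borel of_affine"
    and "delta_robin (affine_interval r) =
      enn2ereal (ennreal K + (\<integral>\<^sup>+x. ennreal (ln (max 1 \<bar>x\<bar>)) \<partial>\<mu>)) - ereal (ln T)"
proof -
  let ?E = "affine_interval r" and ?M = "distr \<mu> borel of_affine"
  have T0: "0 < T" using T by simp
  have min_value: "field_energy T \<mu> = ennreal K + (\<integral>\<^sup>+x. ennreal (ln (max 1 \<bar>x\<bar>)) \<partial>\<mu>)"
    by (rule field_energy_equilibrium[OF \<mu> T0 T(2)]) (rule pot)
  have minimal: "field_energy T \<mu> \<le> field_energy T \<alpha>"
    and minimizer: "field_energy T \<alpha> = field_energy T \<mu> \<Longrightarrow> \<alpha> = \<mu>"
    if "prob_space \<alpha>" "sets \<alpha> = sets borel" "AE x in \<alpha>. \<bar>x\<bar> \<le> r" for \<alpha>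
  proof -
    show "field_energy T \<mu> \<le> field_energy T \<alpha>"
      by (rule field_energy_ge[where K = K, OF \<mu> T0 T(2) _ that]) (rule pot)
    show "field_energy T \<alpha> = field_energy T \<mu> \<Longrightarrow> \<alpha> = \<mu>"
      by (rule field_energy_unique[where K = K, OF \<mu> T0 T(2) _ that]) (simp_all add: pot)
  qed
  have mem: "?M \<in> prob_measures_on ?E" and coord: "distr ?M borel affine_coord = \<mu>"
    using distr_of_affine_in_prob_measures_on[OF \<mu>] by auto
  have energy: "delta_energy ?M = enn2ereal (field_energy T \<mu>) - ereal (ln T)"
    using delta_energy_eq_field_energy[OF r T mem] by (simp add: coord)
  have ge: "delta_energy ?M \<le> delta_energy \<nu>" if \<nu>: "\<nu> \<in> prob_measures_on ?E" for \<nu>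
    unfolding energy delta_energy_eq_field_energy[OF r T \<nu>]
    using minimal[OF coord_distr_facts(1)[OF r T \<nu>] _ coord_distr_facts(2)[OF r T \<nu>]]
    by (intro ereal_minus_mono) (auto simp: less_eq_ennreal.rep_eq[symmetric])
  have cancel: "a - ereal c = b - ereal c \<Longrightarrow> a = b" for a b :: ereal and c
    by (cases a; cases b) auto
  have uniq: "\<nu> = ?M" if \<nu>: "\<nu> \<in> prob_measures_on ?E" and eq: "delta_energy \<nu> = delta_energy ?M" for \<nu>
  proof -
    have "enn2ereal (field_energy T (distr \<nu> borel affine_coord)) = enn2ereal (field_energy T \<mu>)"
      using eq unfolding energy delta_energy_eq_field_energy[OF r T \<nu>] by (rule cancel)
    then have "distr \<nu> borel affine_coord = \<mu>"
      using minimizer[OF coord_distr_facts(1)[OF r T \<nu>] _ coord_distr_facts(2)[OF r T \<nu>]]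
      by (simp add: enn2ereal_inject)
    then show ?thesis using distr_coord_distr[OF r T \<nu>] by simp
  qed
  have robin: "delta_robin ?E = delta_energy ?M"
    unfolding delta_robin_def by (intro antisym INF_lower INF_greatest ge mem)
  show "delta_equilibrium ?E = ?M"
    unfolding delta_equilibrium_def robin by (rule the_equality) (use mem uniq in auto)
  show "delta_robin ?E = enn2ereal (ennreal K + (\<integral>\<^sup>+x. ennreal (ln (max 1 \<bar>x\<bar>)) \<partial>\<mu>)) - ereal (ln T)"
    unfolding robin energy min_value ..
qed

section \<open>The density of the equilibrium law\<close>

definition arcsine_mixture :: "real \<Rightarrow> real \<Rightarrow> real \<Rightarrow> real" where
  "arcsine_mixture r x s = indicator {- truncated_sec r s..truncated_sec r s} x /
     (pi * sqrt ((truncated_sec r s)\<^sup>2 - x\<^sup>2))"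

definition law_density :: "real \<Rightarrow> real \<Rightarrow> ennreal" where
  "law_density r x = (\<integral>\<^sup>+s. ennreal (arcsine_mixture r x s) \<partial>angle_measure)"

lemma arcsine_mixture_measurable [measurable]:
  "(\<lambda>(x, s). arcsine_mixture r x s) \<in> borel_measurable (borel \<Otimes>\<^sub>M borel)"
proof -
  have "(\<lambda>(x, s). arcsine_mixture r x s) = (\<lambda>(x, s).
      (if - truncated_sec r s \<le> x \<and> x \<le> truncated_sec r s then 1 else 0) /
      (pi * sqrt ((truncated_sec r s)\<^sup>2 - x\<^sup>2)))"
    by (auto simp: arcsine_mixture_def fun_eq_iff)
  also have "\<dots> \<in> borel_measurable (borel \<Otimes>\<^sub>M borel)" by measurable
  finally show ?thesis .
qed

lemma law_density_measurable [measurable]: "law_density r \<in> borel_measurable borel"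
  unfolding law_density_def by measurable

lemma nn_integral_equilibrium_law_density:
  assumes "r > 0" and [measurable]: "h \<in> borel_measurable borel"
  shows "(\<integral>\<^sup>+x. h x \<partial>equilibrium_law r) = (\<integral>\<^sup>+x. h x * law_density r x \<partial>lborel)"
proof -
  interpret pair_sigma_finite angle_measure lborel ..
  have "(\<integral>\<^sup>+x. h x \<partial>equilibrium_law r) =
     (\<integral>\<^sup>+s. \<integral>\<^sup>+x. h x * ennreal (arcsine_mixture r x s) \<partial>lborel \<partial>angle_measure)"
    unfolding arcsine_mixture_def
    by (simp only: nn_integral_equilibrium_law[OF assms(2)] nn_integral_arcsine[OF assms(2) truncated_sec_bounds(1)[OF assms(1)]])
  also have "\<dots> = (\<integral>\<^sup>+x. \<integral>\<^sup>+s. h x * ennreal (arcsine_mixture r x s) \<partial>angle_measure \<partial>lborel)"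
    by (rule Fubini'[symmetric]) measurable
  also have "\<dots> = (\<integral>\<^sup>+x. h x * law_density r x \<partial>lborel)"
    unfolding law_density_def by (intro nn_integral_cong nn_integral_cmult) measurable
  finally show ?thesis .
qed

section \<open>Closed form of the averaged arcsine density\<close>

lemma law_density_uminus: "law_density r (- x) = law_density r x"
  unfolding law_density_def arcsine_mixture_def
  by (intro nn_integral_cong arg_cong[where f = ennreal]) (auto simp: indicator_def)

lemma law_density_outside:
  assumes "r > 0" "\<bar>x\<bar> > r"
  shows "law_density r x = 0"
proof -
  have "arcsine_mixture r x s = 0" for s
    using truncated_sec_bounds[OF assms(1), of s] assms by (auto simp: arcsine_mixture_def indicator_def)
  then show ?thesis by (simp add: law_density_def)
qed

text \<open>For \<open>r < 1\<close> every radius is cut at \<open>r\<close>, so the mixture is a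
  single arcsine law.\<close>

lemma law_density_small:
  assumes "0 < r" "r < 1" "\<bar>x\<bar> \<le> r"
  shows "law_density r x = ennreal (equilibrium_density r x)"
proof -
  have "r * \<bar>cos s\<bar> \<le> 1" for s
    using mult_mono[of r 1 "\<bar>cos s\<bar>" 1] assms by simp
  then have "arcsine_mixture r x s = equilibrium_density r x" for s
    using assms truncated_sec_eq(1)[of r s] by (simp add: arcsine_mixture_def equilibrium_density_def abs_le_iff minus_le_iff)
  then show ?thesis by (simp add: law_density_def)
qed

text \<open>With \<open>v = x * sin s\<close> one has
  \<open>1 - (x * cos s)\<^sup>2 = v\<^sup>2 + 1 - x\<^sup>2\<close>, so this is the standard
  primitive \<open>ln (v + sqrt (v\<^sup>2 + 1 - x\<^sup>2))\<close> of
  \<open>1 / sqrt (v\<^sup>2 + 1 - x\<^sup>2)\<close>. It serves \<open>x < 1\<close> and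
  \<open>x > 1\<close> alike.\<close>

lemma has_real_derivative_log_antiderivative:
  fixes x s :: real
  assumes "0 < x" "x * cos s < 1" "0 \<le> cos s" "0 < sin s"
  shows "((\<lambda>s. ln (x * sin s + sqrt (1 - (x * cos s)\<^sup>2)) / x) has_real_derivative
     cos s / sqrt (1 - (x * cos s)\<^sup>2)) (at s)"
proof -
  define w where "w = sqrt (1 - (x * cos s)\<^sup>2)"
  have lt: "(x * cos s)\<^sup>2 < 1"
    using assms by (simp add: abs_square_less_1)
  then have w: "w > 0" by (simp add: w_def)
  have pos: "x * sin s + w > 0" using assms w by (simp add: add_pos_pos)
  have sqrt: "((\<lambda>s. sqrt (1 - (x * cos s)\<^sup>2)) has_real_derivative (x * cos s) * (x * sin s) / w) (at s)"
  proof -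
    have inner: "((\<lambda>s. 1 - (x * cos s)\<^sup>2) has_real_derivative 2 * ((x * cos s) * (x * sin s))) (at s)"
      by (auto intro!: derivative_eq_intros)
    have "0 < 1 - (x * cos s)\<^sup>2" using lt by simp
    from DERIV_chain2[where f = sqrt and g = "\<lambda>s. 1 - (x * cos s)\<^sup>2", OF DERIV_real_sqrt[OF this] inner]
    have "((\<lambda>s. sqrt (1 - (x * cos s)\<^sup>2)) has_real_derivative
        inverse w / 2 * (2 * ((x * cos s) * (x * sin s)))) (at s)"
      unfolding w_def .
    also have "inverse w / 2 * (2 * ((x * cos s) * (x * sin s))) = (x * cos s) * (x * sin s) / w"
      by (simp only: divide_inverse) simp
    finally show ?thesis .
  qed
  have "((\<lambda>s. x * sin s + sqrt (1 - (x * cos s)\<^sup>2)) has_real_derivative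
      x * cos s + (x * cos s) * (x * sin s) / w) (at s)"
    by (intro DERIV_add sqrt DERIV_cmult DERIV_sin)
  from DERIV_cdivide[OF DERIV_chain2[where f = ln and g = "\<lambda>s. x * sin s + sqrt (1 - (x * cos s)\<^sup>2)",
      OF DERIV_ln_divide[OF pos[unfolded w_def]] this], of x]
  have "((\<lambda>s. ln (x * sin s + sqrt (1 - (x * cos s)\<^sup>2)) / x) has_real_derivative
     1 / (x * sin s + w) * (x * cos s + (x * cos s) * (x * sin s) / w) / x) (at s)"
    unfolding w_def .
  also have "1 / (x * sin s + w) * (x * cos s + (x * cos s) * (x * sin s) / w) / x = cos s / w"
  proof -
    have "x * cos s + (x * cos s) * (x * sin s) / w = x * (cos s / w) * (x * sin s + w)"
      using w by (simp add: field_simps)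
    then show ?thesis using pos assms(1) by simp
  qed
  finally show ?thesis by (simp add: w_def)
qed

lemma nn_integral_angle_halves:
  assumes [measurable]: "f \<in> borel_measurable borel" and sym: "\<And>s. f (pi - s) = f s"
  shows "(\<integral>\<^sup>+s. f s \<partial>angle_measure) = ennreal (2 / pi) * (\<integral>\<^sup>+s. f s * indicator {0..pi/2} s \<partial>lborel)"
proof -
  let ?I = "\<integral>\<^sup>+s. f s * indicator {0..pi/2} s \<partial>lborel"
  have "(\<integral>\<^sup>+s. f s * indicator {pi/2..pi} s \<partial>lborel) =
      (\<integral>\<^sup>+s. f (pi + - 1 * s) * indicator {pi/2..pi} (pi + - 1 * s) \<partial>lborel)"
    by (subst nn_integral_real_affine[where c = "- 1" and t = pi]) auto
  also have "\<dots> = ?I"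
    using sym by (intro nn_integral_cong) (auto simp: indicator_def)
  finally have half: "(\<integral>\<^sup>+s. f s * indicator {pi/2..pi} s \<partial>lborel) = ?I" .
  have "(\<integral>\<^sup>+s. f s * indicator {0..pi} s \<partial>lborel) =
      (\<integral>\<^sup>+s. f s * indicator {0..pi/2} s + f s * indicator {pi/2..pi} s \<partial>lborel)"
    using AE_lborel_singleton[of "pi/2"]
    by (intro nn_integral_cong_AE, eventually_elim) (auto simp: indicator_def)
  also have "\<dots> = 2 * ?I"
    by (subst nn_integral_add) (auto simp: half mult_2)
  finally have "(\<integral>\<^sup>+s. f s \<partial>angle_measure) = ennreal (1 / pi) * (2 * ?I)"
    by (simp add: nn_integral_angle_measure)
  also have "\<dots> = ennreal (1 / pi) * ennreal 2 * ?I" by (simp add: mult.assoc)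
  also have "ennreal (1 / pi) * ennreal 2 = ennreal (2 / pi)" by (subst ennreal_mult[symmetric]) auto
  finally show ?thesis .
qed

text \<open>The quarter circle splits by the radius \<open>S\<close>: on \<open>(0, a)\<close> it is
  below \<open>x\<close> and the arcsine density at \<open>x\<close> is zero; on
  \<open>(a, b)\<close> it is \<open>1 / cos s\<close> and exceeds \<open>x\<close>, giving the
  logarithm; on \<open>(b, pi/2)\<close> it is \<open>r\<close> and the integrand is constant,
  giving the \<open>arcsin\<close> term.\<close>

lemma has_integral_arcsine_mixture:
  assumes r: "r \<ge> 1" and x: "0 < x" "x < r" "x \<noteq> 1"
  defines "p \<equiv> sqrt (r\<^sup>2 - x\<^sup>2)" and "q \<equiv> sqrt (r\<^sup>2 - 1)"
  shows "(arcsine_mixture r x has_integral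
    (ln ((x * q + p) / r) - ln (sqrt \<bar>1 - x\<^sup>2\<bar>)) / (pi * x) + arcsin (1 / r) / (pi * p)) {0..pi/2}"
proof -
  \<comment> \<open>The clipping at 1 makes \<open>a = 0\<close> for \<open>x < 1\<close>, when
    every radius exceeds \<open>x\<close> and the first piece is empty.\<close>
  define a where "a = arccos (min 1 (1 / x))"
  define b where "b = arccos (1 / r)"
  have r0: "r > 0" using r by simp
  have min: "0 < min 1 (1 / x)" "min 1 (1 / x) \<le> 1" "1 / r \<le> min 1 (1 / x)"
    using x r by (auto simp: field_simps)
  have lower: "- 1 \<le> min 1 (1 / x)" "- 1 \<le> 1 / x" "- 1 \<le> 1 / r" "0 \<le> 1 / r" "1 / r \<le> 1"
  proof -
    have "0 < 1 / x" "0 < 1 / r" using x r0 by auto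
    then show "- 1 \<le> min 1 (1 / x)" "- 1 \<le> 1 / x" "- 1 \<le> 1 / r" "0 \<le> 1 / r" "1 / r \<le> 1"
      using min by linarith+
  qed
  have abs1: "\<bar>min 1 (1 / x)\<bar> \<le> 1" "\<bar>1 / r\<bar> \<le> 1"
    using lower min(2) by linarith+
  have cos_a: "cos a = min 1 (1 / x)" and cos_b: "cos b = 1 / r"
    unfolding a_def b_def by (rule cos_arccos_abs abs1)+
  have sin_a: "sin a = sqrt (1 - (min 1 (1 / x))\<^sup>2)" and sin_b: "sin b = sqrt (1 - (1 / r)\<^sup>2)"
    unfolding a_def b_def by (rule sin_arccos_abs abs1)+
  have ab: "0 \<le> a" "a \<le> b" "b \<le> pi / 2"
    unfolding a_def b_def
    using arccos_lbound[OF lower(1) min(2)] arccos_le_mono[OF abs1] min(3) arccos_le_pi2[OF lower(4,5)]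
    by simp_all
  have mono: "cos t < cos s" if "0 \<le> s" "s < t" "t \<le> pi / 2" for s t
    using that by (intro cos_monotone_0_pi) auto
  have cospos: "0 \<le> cos s" if "0 \<le> s" "s \<le> pi / 2" for s
    using that by (intro cos_ge_zero) auto
  have i1: "(arcsine_mixture r x has_integral 0 - 0) {0..a}"
  proof (rule fundamental_theorem_of_calculus_interior[OF ab(1)])
    fix s assume s: "s \<in> {0<..<a}"
    have "cos a < cos s" using s ab by (intro mono) auto
    \<comment> \<open>A cosine above \<open>cos a\<close> excludes the clipped value 1.\<close>
    moreover have "cos a = 1 / x"
      using calculation cos_a cos_le_one[of s] by linarith
    ultimately have c: "1 / x < cos s" "1 / r < cos s"
      using cos_a min(3) by linarith+
    then have "cos s > 0" using x by (auto intro: less_trans[of 0 "1/x"])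
    then have "truncated_sec r s = 1 / cos s" using c r0
      by (subst truncated_sec_eq(2)) (auto simp: field_simps)
    moreover have "1 / cos s < x" using c \<open>cos s > 0\<close> x by (simp add: field_simps)
    ultimately have "arcsine_mixture r x s = 0" by (simp add: arcsine_mixture_def)
    then show "((\<lambda>_. 0) has_vector_derivative arcsine_mixture r x s) (at s)"
      by simp
  qed auto
  define H where "H s = ln (x * sin s + sqrt (1 - (x * cos s)\<^sup>2)) / x" for s
  have i2: "(arcsine_mixture r x has_integral H b / pi - H a / pi) {a..b}"
  proof (rule fundamental_theorem_of_calculus_interior[OF ab(2)])
    show "continuous_on {a..b} (\<lambda>s. H s / pi)"
    proof -
      \<comment> \<open>The sine vanishes only at \<open>s = 0\<close>, which is in range only if
        \<open>a = 0\<close>; then \<open>x < 1\<close> and the root is positive. The excluded value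
        \<open>x = 1\<close> is the singularity of the logarithm.\<close>
      have "x * sin s + sqrt (1 - (x * cos s)\<^sup>2) \<noteq> 0" if s: "s \<in> {a..b}" for s
      proof (cases "s = 0")
        case True
        then have "a = 0" using s ab by auto
        then have "x < 1" using cos_a x by (auto simp: min_def field_simps split: if_splits)
        then have "x\<^sup>2 < 1" using x by (simp add: abs_square_less_1)
        then show ?thesis using True by simp
      next
        case False
        then have "sin s > 0" using s ab by (intro sin_gt_zero) auto
        moreover have "0 \<le> cos s" using s ab by (intro cospos) auto
        moreover have "cos s \<le> cos a" using s ab by (intro cos_monotone_0_pi_le) auto
        then have "cos s \<le> 1 / x" using cos_a by simp
        then have "x * cos s \<le> 1" using x by (simp add: field_simps)
        then have "(x * cos s)\<^sup>2 \<le> 1" using \<open>0 \<le> cos s\<close> x by (simp add: abs_square_le_1)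
        then have "sqrt (1 - (x * cos s)\<^sup>2) \<ge> 0" by simp
        ultimately show ?thesis using x by (smt (verit) mult_pos_pos)
      qed
      then show ?thesis unfolding H_def using x by (intro continuous_intros) auto
    qed
    fix s assume s: "s \<in> {a<..<b}"
    have c: "cos b < cos s" "cos s < cos a" using s ab by (auto intro!: mono)
    then have cs: "1 / r < cos s" "cos s < 1 / x" using cos_a cos_b by auto
    then have cpos: "cos s > 0" using r0 by (auto intro: less_trans[of 0 "1/r"])
    have sec: "truncated_sec r s = 1 / cos s"
      using cs cpos r0 by (subst truncated_sec_eq(2)) (auto simp: field_simps)
    have xc: "x * cos s < 1" using cs x by (simp add: field_simps)
    then have "x < 1 / cos s" using cpos by (simp add: field_simps)
    moreover have "sqrt ((1 / cos s)\<^sup>2 - x\<^sup>2) = sqrt (1 - (x * cos s)\<^sup>2) / cos s"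
    proof -
      have "(1 / cos s)\<^sup>2 - x\<^sup>2 = (1 - (x * cos s)\<^sup>2) / (cos s)\<^sup>2"
        using cpos by (simp add: power_divide power_mult_distrib diff_divide_distrib)
      then show ?thesis using cpos by (simp add: real_sqrt_divide)
    qed
    ultimately have mix: "arcsine_mixture r x s = cos s / sqrt (1 - (x * cos s)\<^sup>2) / pi"
      using x cpos by (simp add: arcsine_mixture_def sec indicator_def)
    have "sin s > 0" using s ab by (intro sin_gt_zero) auto
    from has_real_derivative_log_antiderivative[OF x(1) xc _ this]
    show "((\<lambda>s. H s / pi) has_vector_derivative arcsine_mixture r x s) (at s)"
      unfolding mix H_def has_real_derivative_iff_has_vector_derivative[symmetric]
      using cpos by (intro DERIV_cdivide) auto
  qed
  have "x\<^sup>2 < r\<^sup>2" using x by (intro power_strict_mono) auto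
  then have p: "p > 0" by (simp add: p_def)
  have i3: "(arcsine_mixture r x has_integral (pi / 2) / (pi * p) - b / (pi * p)) {b..pi/2}"
  proof (rule fundamental_theorem_of_calculus_interior[OF ab(3)])
    fix s assume s: "s \<in> {b<..<pi/2}"
    have "cos s < cos b" "0 \<le> cos s" using s ab by (auto intro!: mono cospos)
    then have "truncated_sec r s = r" using r0
      by (intro truncated_sec_eq(1)) (auto simp: cos_b field_simps)
    then have "arcsine_mixture r x s = 1 / (pi * p)"
      using x by (simp add: arcsine_mixture_def p_def)
    then show "((\<lambda>s. s / (pi * p)) has_vector_derivative arcsine_mixture r x s) (at s)"
      unfolding has_real_derivative_iff_has_vector_derivative[symmetric]
      using p by (auto intro!: derivative_eq_intros)
  qed (use p in \<open>auto intro!: continuous_intros\<close>)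
  have Hb: "H b = ln ((x * q + p) / r) / x"
  proof -
    have "1 - (1 / r)\<^sup>2 = (r\<^sup>2 - 1) / r\<^sup>2"
      using r0 by (simp add: power_divide diff_divide_distrib)
    then have "sin b = q / r"
      unfolding sin_b q_def using r0 by (simp add: real_sqrt_divide)
    moreover have "1 - (x * cos b)\<^sup>2 = (r\<^sup>2 - x\<^sup>2) / r\<^sup>2"
      unfolding cos_b using r0 by (simp add: power_divide diff_divide_distrib)
    then have "sqrt (1 - (x * cos b)\<^sup>2) = p / r"
      using r0 by (simp add: p_def real_sqrt_divide)
    ultimately show ?thesis by (simp add: H_def add_divide_distrib)
  qed
  have Ha: "H a = ln (sqrt \<bar>1 - x\<^sup>2\<bar>) / x"
  proof (cases "x < 1")
    case True
    then have "cos a = 1" "sin a = 0" "x\<^sup>2 < 1"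
      using x by (auto simp: cos_a sin_a min_def field_simps abs_square_less_1)
    then show ?thesis by (simp add: H_def)
  next
    case False
    then have x1: "x > 1" using x by simp
    then have "cos a = 1 / x" by (auto simp: cos_a min_def field_simps)
    moreover have "x * sin a = sqrt (x\<^sup>2 - 1)"
    proof -
      have "sin a = sqrt ((x\<^sup>2 - 1) / x\<^sup>2)"
        using x1 by (simp add: sin_a min_def power_divide diff_divide_distrib)
      then show ?thesis using x1 by (simp add: real_sqrt_divide)
    qed
    moreover have "\<bar>1 - x\<^sup>2\<bar> = x\<^sup>2 - 1" using x1 by (simp add: one_le_power)
    ultimately show ?thesis using x1 by (simp add: H_def)
  qed
  have asin: "arcsin (1 / r) = pi / 2 - b"
    unfolding b_def using r by (intro arcsin_arccos_eq) (auto simp: field_simps)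
  have "(arcsine_mixture r x has_integral
      ((0 - 0) + (H b / pi - H a / pi)) + ((pi / 2) / (pi * p) - b / (pi * p))) {0..pi/2}"
    using ab by (intro has_integral_combine[OF _ _ has_integral_combine[OF _ _ i1 i2] i3]) auto
  also have "((0 - 0) + (H b / pi - H a / pi)) + ((pi / 2) / (pi * p) - b / (pi * p)) =
    (ln ((x * q + p) / r) - ln (sqrt \<bar>1 - x\<^sup>2\<bar>)) / (pi * x) + arcsin (1 / r) / (pi * p)"
    unfolding Ha Hb asin by (simp add: diff_divide_distrib mult.commute)
  finally show ?thesis .
qed

text \<open>The integration yields \<open>ln (A / sqrt \<bar>1 - x\<^sup>2\<bar>)\<close>; doubling
  it gives the logarithm of \<open>A\<^sup>2 / \<bar>1 - x\<^sup>2\<bar>\<close>, which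
  \<open>key\<close> identifies with the quotient in the stated density.\<close>

lemma equilibrium_density_eq:
  assumes r: "r \<ge> 1" and x: "0 < x" "x < r" "x \<noteq> 1"
  defines "p \<equiv> sqrt (r\<^sup>2 - x\<^sup>2)" and "q \<equiv> sqrt (r\<^sup>2 - 1)"
  shows "equilibrium_density r x = 2 / pi *
    ((ln ((x * q + p) / r) - ln (sqrt \<bar>1 - x\<^sup>2\<bar>)) / (pi * x) + arcsin (1 / r) / (pi * p))"
proof -
  have xr: "x\<^sup>2 < r\<^sup>2" using x by (intro power_strict_mono) auto
  have r1: "1 \<le> r\<^sup>2" using r by simp
  have p: "p > 0" "p\<^sup>2 = r\<^sup>2 - x\<^sup>2" and q: "q \<ge> 0" "q\<^sup>2 = r\<^sup>2 - 1"
    using xr r1 by (auto simp: p_def q_def)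
  have "r * 1 \<le> r * r" using r by (intro mult_left_mono) auto
  then have rx: "x < r\<^sup>2" using x unfolding power2_eq_square by linarith
  define A where "A = (x * q + p) / r"
  define N where "N = r\<^sup>2 - x + p * q"
  define M where "M = r\<^sup>2 + x + p * q"
  have A: "A > 0" using x p q r by (simp add: A_def add_nonneg_pos)
  have NM: "N > 0" "M > 0" using rx x p q by (auto simp: N_def M_def add_pos_nonneg)
  have key: "(x + 1)\<^sup>2 * N = A\<^sup>2 * M"
  proof -
    \<comment> \<open>A polynomial identity modulo \<open>p\<^sup>2 = r\<^sup>2 - x\<^sup>2\<close>
      and \<open>q\<^sup>2 = r\<^sup>2 - 1\<close>.\<close>
    have "r\<^sup>2 * ((x + 1)\<^sup>2 * N) = (x * q + p)\<^sup>2 * M"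
      unfolding N_def M_def using p(2) q(2) by algebra
    then show ?thesis using r unfolding A_def by (simp add: power_divide field_simps)
  qed
  have absx: "\<bar>1 - x\<^sup>2\<bar> = \<bar>x - 1\<bar> * (x + 1)"
  proof -
    have "1 - x\<^sup>2 = (1 - x) * (x + 1)" by (simp add: power2_eq_square algebra_simps)
    then have "\<bar>1 - x\<^sup>2\<bar> = \<bar>1 - x\<bar> * \<bar>x + 1\<bar>" by (simp only: abs_mult)
    then show ?thesis using x by (simp add: abs_minus_commute)
  qed
  have "\<bar>((x + 1) * N) / ((x - 1) * M)\<bar> = ((x + 1) * N) / (\<bar>x - 1\<bar> * M)"
    using x NM by (simp add: abs_mult abs_divide)
  also have "\<dots> = A\<^sup>2 / \<bar>1 - x\<^sup>2\<bar>"
  proof -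
    have "((x + 1) * N) / (\<bar>x - 1\<bar> * M) = ((x + 1) * N * (x + 1)) / (\<bar>x - 1\<bar> * M * (x + 1))"
      using x by (subst mult_divide_mult_cancel_right) auto
    also have "(x + 1) * N * (x + 1) = A\<^sup>2 * M"
      unfolding key[symmetric] by (simp add: power2_eq_square)
    also have "A\<^sup>2 * M / (\<bar>x - 1\<bar> * M * (x + 1)) = A\<^sup>2 / (\<bar>x - 1\<bar> * (x + 1))"
      using NM by simp
    finally show ?thesis unfolding absx .
  qed
  also have "ln \<dots> = 2 * (ln A - ln (sqrt \<bar>1 - x\<^sup>2\<bar>))"
  proof -
    have "\<bar>1 - x\<^sup>2\<bar> > 0" unfolding absx using x by simp
    then show ?thesis using A by (simp add: ln_div ln_realpow ln_sqrt)
  qed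
  finally have "ln \<bar>((x + 1) * N) / ((x - 1) * M)\<bar> = 2 * (ln A - ln (sqrt \<bar>1 - x\<^sup>2\<bar>))" .
  then show ?thesis
    using r unfolding equilibrium_density_def p_def[symmetric] q_def[symmetric]
      N_def[symmetric] M_def[symmetric] A_def[symmetric]
    by (simp add: power2_eq_square field_simps)
qed

text \<open>The quotient inside the logarithm turns into its reciprocal, so the logarithm changes
  sign together with the factor \<open>1 / x\<close>.\<close>

lemma equilibrium_density_uminus:
  assumes "\<bar>x\<bar> \<le> r"
  shows "equilibrium_density r (- x) = equilibrium_density r x"
proof -
  define s where "s = sqrt (r\<^sup>2 - x\<^sup>2) * sqrt (r\<^sup>2 - 1)"
  have "ln \<bar>((- x + 1) * (r\<^sup>2 - - x + s)) / ((- x - 1) * (r\<^sup>2 + - x + s))\<bar> =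
     - ln \<bar>((x + 1) * (r\<^sup>2 - x + s)) / ((x - 1) * (r\<^sup>2 + x + s))\<bar>"
  proof -
    have "((- x + 1) * (r\<^sup>2 - - x + s)) / ((- x - 1) * (r\<^sup>2 + - x + s)) =
      inverse (((x + 1) * (r\<^sup>2 - x + s)) / ((x - 1) * (r\<^sup>2 + x + s)))"
    proof -
      have "- x + 1 = - (x - 1)" "- x - 1 = - (x + 1)" by auto
      then show ?thesis
        by (simp only: mult_minus_left minus_divide_divide inverse_divide diff_minus_eq_add add_uminus_conv_diff)
    qed
    then show ?thesis by (simp only: abs_inverse ln_inverse)
  qed
  then show ?thesis
    by (simp add: equilibrium_density_def s_def)
qed

text \<open>Excluded are the points where the closed form divides by \<open>x\<close>, where its
  logarithm is singular, and the ends of the interval. Nonnegativity is recorded because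
  \<open>ennreal\<close> hides negative values, and the real density must be recovered
  later.\<close>

lemma law_density_large:
  assumes r: "r \<ge> 1" and x: "\<bar>x\<bar> < r" "x \<noteq> 0" "\<bar>x\<bar> \<noteq> 1"
  shows "law_density r x = ennreal (equilibrium_density r x)" "0 \<le> equilibrium_density r x"
proof -
  have *: "law_density r x = ennreal (equilibrium_density r x) \<and> 0 \<le> equilibrium_density r x"
    if x: "0 < x" "x < r" "x \<noteq> 1" for x
  proof -
    define I where "I = (ln ((x * sqrt (r\<^sup>2 - 1) + sqrt (r\<^sup>2 - x\<^sup>2)) / r) - ln (sqrt \<bar>1 - x\<^sup>2\<bar>)) / (pi * x) +
      arcsin (1 / r) / (pi * sqrt (r\<^sup>2 - x\<^sup>2))"
    have nn: "0 \<le> arcsine_mixture r x s" for s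
    proof (cases "x \<in> {- truncated_sec r s..truncated_sec r s}")
      case True
      then have "x\<^sup>2 \<le> (truncated_sec r s)\<^sup>2" using x by (intro power_mono) auto
      then show ?thesis by (simp add: arcsine_mixture_def)
    qed (auto simp: arcsine_mixture_def)
    have int: "(arcsine_mixture r x has_integral I) {0..pi/2}"
      unfolding I_def by (rule has_integral_arcsine_mixture[OF r x])
    have "I \<ge> 0" using int nn by (rule has_integral_nonneg)
    have m: "arcsine_mixture r x \<in> borel_measurable borel"
      using measurable_compose_Pair1[OF _ arcsine_mixture_measurable[of r], of x] by simp
    have "law_density r x = ennreal (2 / pi) * (\<integral>\<^sup>+s. ennreal (arcsine_mixture r x s) * indicator {0..pi/2} s \<partial>lborel)"
      unfolding law_density_def
    proof (rule nn_integral_angle_halves)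
      show "(\<lambda>s. ennreal (arcsine_mixture r x s)) \<in> borel_measurable borel"
        using m by measurable
    qed (simp add: arcsine_mixture_def truncated_sec_def cos_diff)
    also have "\<dots> = ennreal (2 / pi) * ennreal I"
      using nn int by (simp only: nn_integral_has_integral_lebesgue')
    also have "\<dots> = ennreal (2 / pi * I)"
      using \<open>I \<ge> 0\<close> by (intro ennreal_mult[symmetric]) auto
    finally have "law_density r x = ennreal (2 / pi * I)" .
    moreover have "equilibrium_density r x = 2 / pi * I"
      unfolding I_def by (rule equilibrium_density_eq[OF r x])
    moreover have "0 \<le> 2 / pi * I" using \<open>I \<ge> 0\<close> by simp
    ultimately show ?thesis by (simp only: simp_thms)
  qed
  show "law_density r x = ennreal (equilibrium_density r x)" "0 \<le> equilibrium_density r x"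
    using *[of x] *[of "- x"] x law_density_uminus[of r x] equilibrium_density_uminus[of x r]
    by (cases "x > 0"; force)+
qed

lemma AE_law_density:
  assumes "r > 0"
  shows "AE x in lborel. \<bar>x\<bar> \<le> r \<longrightarrow>
    law_density r x = ennreal (equilibrium_density r x) \<and> 0 \<le> equilibrium_density r x"
proof (cases "r < 1")
  case True
  have "0 \<le> equilibrium_density r x" if "\<bar>x\<bar> \<le> r" for x
    using that True assms abs_le_square_iff[of x r] by (simp add: equilibrium_density_def)
  then show ?thesis using True law_density_small[OF assms True] by auto
next
  case False
  then show ?thesis
    using AE_lborel_singleton[of r] AE_lborel_singleton[of "- r"] AE_lborel_singleton[of 0]
      AE_lborel_singleton[of 1] AE_lborel_singleton[of "- 1"]
  proof eventually_elim
    case (elim x)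
    then have "\<bar>x\<bar> < r" "\<bar>x\<bar> \<noteq> 1" if "\<bar>x\<bar> \<le> r" using that by (auto simp: abs_if split: if_splits)
    then show ?case using law_density_large[of r x] elim False by auto
  qed
qed

section \<open>The two integrals in the Robin constant\<close>

lemma nn_integral_even_split:
  fixes f :: "real \<Rightarrow> ennreal"
  assumes [measurable]: "f \<in> borel_measurable borel"
    and even: "\<And>x. f (- x) = f x" and zero: "\<And>x. \<bar>x\<bar> < 1 \<Longrightarrow> f x = 0"
  shows "(\<integral>\<^sup>+x. f x \<partial>lborel) = 2 * (\<integral>\<^sup>+x. f x * indicator {1..} x \<partial>lborel)"
proof -
  have "(\<integral>\<^sup>+x. f x \<partial>lborel) = (\<integral>\<^sup>+x. f x * indicator {1..} x + f x * indicator {..-1} x \<partial>lborel)"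
    using zero by (intro nn_integral_cong) (auto simp: indicator_def)
  also have "\<dots> = (\<integral>\<^sup>+x. f x * indicator {1..} x \<partial>lborel) + (\<integral>\<^sup>+x. f x * indicator {..-1} x \<partial>lborel)"
    by (rule nn_integral_add) measurable
  also have "(\<integral>\<^sup>+x. f x * indicator {..-1} x \<partial>lborel) =
      (\<integral>\<^sup>+x. f (0 + - 1 * x) * indicator {..-1} (0 + - 1 * x) \<partial>lborel)"
    by (subst nn_integral_real_affine[where c = "- 1" and t = 0]) auto
  also have "\<dots> = (\<integral>\<^sup>+x. f x * indicator {1..} x \<partial>lborel)"
    using even by (intro nn_integral_cong) (auto simp: indicator_def)
  finally show ?thesis by (simp add: mult_2)
qed

text \<open>The variable \<open>r * cos s\<close> has the arcsine law on \<open>[-r, r]\<close>. The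
  positive part of the logarithm lives on \<open>1 \<le> \<bar>x\<bar> \<le> r\<close>, and by
  evenness the two sides together turn \<open>1 / pi\<close> into \<open>2 / pi\<close>.\<close>

lemma integral_positive_log_cos:
  assumes r: "r \<ge> 1"
  shows "(\<integral>s. max 0 (ln (r * \<bar>cos s\<bar>)) \<partial>angle_measure) =
    2 / pi * (LBINT x:{1..r}. ln x / sqrt (r\<^sup>2 - x\<^sup>2))"
proof -
  have r0: "r > 0" using r by simp
  define h where "h x = ennreal (max 0 (ln \<bar>x\<bar>))" for x :: real
  have [measurable]: "h \<in> borel_measurable borel" unfolding h_def by measurable
  define w where "w x = indicator {1..r} x * (ln x / sqrt (r\<^sup>2 - x\<^sup>2))" for x
  have w_nonneg: "0 \<le> w x" for x
  proof (cases "x \<in> {1..r}")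
    case True
    then have "x\<^sup>2 \<le> r\<^sup>2" by (intro power_mono) auto
    then show ?thesis using True by (simp add: w_def)
  qed (simp add: w_def)
  have "(\<integral>\<^sup>+s. ennreal (max 0 (ln (r * \<bar>cos s\<bar>))) \<partial>angle_measure) = (\<integral>\<^sup>+s. h (r * cos s) \<partial>angle_measure)"
    using r0 by (simp add: h_def abs_mult)
  also have "\<dots> = (\<integral>\<^sup>+x. h x * ennreal (indicator {-r..r} x / (pi * sqrt (r\<^sup>2 - x\<^sup>2))) \<partial>lborel)"
    by (rule nn_integral_arcsine[OF _ r0]) measurable
  also have "\<dots> = 2 * (\<integral>\<^sup>+x. h x * ennreal (indicator {-r..r} x / (pi * sqrt (r\<^sup>2 - x\<^sup>2))) * indicator {1..} x \<partial>lborel)"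
  proof (rule nn_integral_even_split)
    fix x :: real assume "\<bar>x\<bar> < 1"
    then have "ln \<bar>x\<bar> \<le> 0" by (cases "x = 0") auto
    then show "h x * ennreal (indicator {-r..r} x / (pi * sqrt (r\<^sup>2 - x\<^sup>2))) = 0" by (simp add: h_def)
  qed (auto simp: h_def indicator_def)
  also have "\<dots> = 2 * (\<integral>\<^sup>+x. ennreal (1 / pi) * ennreal (w x) \<partial>lborel)"
  proof (rule arg_cong[where f = "(*) 2"], rule nn_integral_cong)
    fix x
    show "h x * ennreal (indicator {-r..r} x / (pi * sqrt (r\<^sup>2 - x\<^sup>2))) * indicator {1..} x =
        ennreal (1 / pi) * ennreal (w x)"
    proof (cases "x \<in> {1..r}")
      case True
      then have "x\<^sup>2 \<le> r\<^sup>2" by (intro power_mono) auto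
      then show ?thesis using True
        by (simp add: h_def w_def flip: ennreal_mult)
    qed (auto simp: w_def indicator_def)
  qed
  also have "\<dots> = 2 * (ennreal (1 / pi) * (\<integral>\<^sup>+x. ennreal (w x) \<partial>lborel))"
    by (subst nn_integral_cmult) (auto simp: w_def)
  also have "\<dots> = ennreal (2 / pi) * (\<integral>\<^sup>+x. ennreal (w x) \<partial>lborel)"
  proof -
    have "2 * (ennreal (1 / pi) * z) = ennreal (2 / pi) * z" for z
    proof -
      have "2 * ennreal (1 / pi) = ennreal (2 / pi)"
        by (subst ennreal_numeral[symmetric], subst ennreal_mult[symmetric]) auto
      then show ?thesis by (simp add: mult.assoc[symmetric])
    qed
    then show ?thesis .
  qed
  \<comment> \<open>For nonnegative measurable functions the Bochner integral is
    \<open>enn2real\<close> of the nonnegative integral whether or not the latter is finite, so no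
    integrability proof is required.\<close>
  finally have "enn2real (\<integral>\<^sup>+s. ennreal (max 0 (ln (r * \<bar>cos s\<bar>))) \<partial>angle_measure) =
      2 / pi * enn2real (\<integral>\<^sup>+x. ennreal (w x) \<partial>lborel)"
    by (simp add: enn2real_mult)
  moreover have "(\<integral>s. max 0 (ln (r * \<bar>cos s\<bar>)) \<partial>angle_measure) =
      enn2real (\<integral>\<^sup>+s. ennreal (max 0 (ln (r * \<bar>cos s\<bar>))) \<partial>angle_measure)"
    by (rule integral_eq_nn_integral) auto
  moreover have "(LBINT x:{1..r}. ln x / sqrt (r\<^sup>2 - x\<^sup>2)) = enn2real (\<integral>\<^sup>+x. ennreal (w x) \<partial>lborel)"
    unfolding set_lebesgue_integral_def real_scaleR_def w_def[symmetric]
    by (rule integral_eq_nn_integral) (use w_nonneg in \<open>auto simp: w_def\<close>)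
  ultimately show ?thesis by simp
qed

text \<open>The law is symmetric, as its density is even, so the field integral is twice its part
  over \<open>[1, r]\<close>.\<close>

lemma nn_integral_log_equilibrium_law:
  assumes r: "r > 0"
  shows "(\<integral>\<^sup>+x. ennreal (ln (max 1 \<bar>x\<bar>)) \<partial>equilibrium_law r) =
    ennreal (2 * (\<integral>x. indicator {1..r} x * ln x \<partial>equilibrium_law r))"
proof -
  interpret law: prob_space "equilibrium_law r" by (rule prob_space_equilibrium_law)
  define g where "g x = indicator {1..r} x * ln x" for x :: real
  have [measurable]: "g \<in> borel_measurable borel" unfolding g_def by measurable
  have g: "0 \<le> g x" "g x \<le> \<bar>ln r\<bar>" for x
    by (auto simp: g_def indicator_def)
  have int: "integrable (equilibrium_law r) g"
    using g by (intro law.integrable_const_bound[where B = "\<bar>ln r\<bar>"]) auto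
  have "(\<integral>\<^sup>+x. ennreal (ln (max 1 \<bar>x\<bar>)) \<partial>equilibrium_law r) =
     (\<integral>\<^sup>+x. ennreal (ln (max 1 \<bar>x\<bar>)) * law_density r x \<partial>lborel)"
    using r by (rule nn_integral_equilibrium_law_density) measurable
  also have "\<dots> = 2 * (\<integral>\<^sup>+x. ennreal (ln (max 1 \<bar>x\<bar>)) * law_density r x * indicator {1..} x \<partial>lborel)"
    by (rule nn_integral_even_split) (auto simp: law_density_uminus)
  also have "(\<integral>\<^sup>+x. ennreal (ln (max 1 \<bar>x\<bar>)) * law_density r x * indicator {1..} x \<partial>lborel) =
      (\<integral>\<^sup>+x. ennreal (g x) * law_density r x \<partial>lborel)"
  proof (intro nn_integral_cong)
    fix x
    show "ennreal (ln (max 1 \<bar>x\<bar>)) * law_density r x * indicator {1..} x = ennreal (g x) * law_density r x"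
      using law_density_outside[OF r, of x] by (cases "x \<le> r") (auto simp: g_def indicator_def)
  qed
  also have "\<dots> = (\<integral>\<^sup>+x. ennreal (g x) \<partial>equilibrium_law r)"
    by (rule nn_integral_equilibrium_law_density[OF r, symmetric]) measurable
  also have "\<dots> = ennreal (\<integral>x. g x \<partial>equilibrium_law r)"
    using g by (intro nn_integral_eq_integral int) auto
  also have "2 * \<dots> = ennreal (2 * (\<integral>x. g x \<partial>equilibrium_law r))"
    using g by (subst ennreal_mult) (auto intro: integral_nonneg_AE)
  finally show ?thesis by (simp add: g_def)
qed

section \<open>Equilibrium measure and Robin constant\<close>

lemma equilibrium_law_Frostman:
  assumes r: "r > 0"
  shows "delta_equilibrium (affine_interval r) = distr (equilibrium_law r) borel of_affine"
    and "delta_robin (affine_interval r) =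
      ereal (robin_shift r + 2 * (\<integral>x. indicator {1..r} x * ln x \<partial>equilibrium_law r))"
proof -
  \<comment> \<open>Any \<open>T\<close> with \<open>1 \<le> T\<close> and
    \<open>2 * r \<le> T\<close> would do; its logarithm cancels from the Robin constant.\<close>
  define T where "T = 2 * r + 1"
  have T: "1 \<le> T" "2 * r \<le> T" using r by (auto simp: T_def)
  have pot: "(\<integral>\<^sup>+y. log_kernel T x y \<partial>equilibrium_law r) + ennreal (ln (max 1 \<bar>x\<bar>)) =
      ennreal (ln T + robin_shift r)" if "\<bar>x\<bar> \<le> r" for x
  proof -
    have "(\<integral>\<^sup>+y. log_kernel T x y \<partial>equilibrium_law r) + ennreal (ln (max 1 \<bar>x\<bar>)) =
      ennreal ((ln T + robin_shift r - ln (max 1 \<bar>x\<bar>)) + ln (max 1 \<bar>x\<bar>))"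
      unfolding equilibrium_law_potential(1)[OF r that T(2)]
      using equilibrium_law_potential(2)[OF r that T(2)] by (intro ennreal_plus[symmetric]) auto
    then show ?thesis by simp
  qed
  have K: "0 \<le> ln T + robin_shift r"
    using equilibrium_law_potential(2)[OF r _ T(2), of 0] r by simp
  have J: "0 \<le> (\<integral>x. indicator {1..r} x * ln x \<partial>equilibrium_law r)"
    by (intro integral_nonneg_AE AE_I2) (auto simp: indicator_def)
  show "delta_equilibrium (affine_interval r) = distr (equilibrium_law r) borel of_affine"
    by (rule delta_equilibrium_Frostman(1)[OF r T prob_space_equilibrium_law _ AE_equilibrium_law[OF r]])
       (simp_all add: pot)
  have "delta_robin (affine_interval r) =
      enn2ereal (ennreal (ln T + robin_shift r) + (\<integral>\<^sup>+x. ennreal (ln (max 1 \<bar>x\<bar>)) \<partial>equilibrium_law r)) - ereal (ln T)"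
    by (rule delta_equilibrium_Frostman(2)[OF r T prob_space_equilibrium_law _ AE_equilibrium_law[OF r]])
       (simp_all add: pot)
  also have "\<dots> = ereal ((ln T + robin_shift r) + 2 * (\<integral>x. indicator {1..r} x * ln x \<partial>equilibrium_law r)) - ereal (ln T)"
    unfolding nn_integral_log_equilibrium_law[OF r] using K J
    by (simp only: ennreal_plus[symmetric] enn2ereal_ennreal mult_nonneg_nonneg zero_le_numeral add_nonneg_nonneg)
  finally show "delta_robin (affine_interval r) =
      ereal (robin_shift r + 2 * (\<integral>x. indicator {1..r} x * ln x \<partial>equilibrium_law r))"
    by simp
qed

lemma set_integral_of_affine:
  "(LINT p:of_affine ` {1..r}|distr (equilibrium_law r) borel of_affine. ln (affine_coord p)) =
    (\<integral>x. indicator {1..r} x * ln x \<partial>equilibrium_law r)"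
  unfolding set_lebesgue_integral_def
  by (subst integral_distr) (auto simp: indicator_def inj_image_mem_iff[OF inj_of_affine]
      intro!: Bochner_Integration.integral_cong)

lemma density_lebesgue_on_interval:
  assumes r: "r > 0"
  shows "density (lebesgue_on_interval r) (\<lambda>p. ennreal (equilibrium_density r (affine_coord p))) =
    distr (equilibrium_law r) borel of_affine"
proof (rule measure_eqI)
  have [measurable]: "equilibrium_density r \<in> borel_measurable borel"
    unfolding equilibrium_density_def by measurable
  have s[simp, measurable_cong]: "sets (lebesgue_on_interval r) = sets borel"
    by (simp add: lebesgue_on_interval_def)
  have [measurable]: "of_affine \<in> restrict_space lborel {-r..r} \<rightarrow>\<^sub>M borel"
    by (rule measurable_restrict_space1) simp
  show "sets (density (lebesgue_on_interval r) (\<lambda>p. ennreal (equilibrium_density r (affine_coord p)))) =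
    sets (distr (equilibrium_law r) borel of_affine)" by simp
  fix B assume "B \<in> sets (density (lebesgue_on_interval r) (\<lambda>p. ennreal (equilibrium_density r (affine_coord p))))"
  then have [measurable]: "B \<in> sets borel" by simp
  have "emeasure (density (lebesgue_on_interval r) (\<lambda>p. ennreal (equilibrium_density r (affine_coord p)))) B =
      (\<integral>\<^sup>+p. ennreal (equilibrium_density r (affine_coord p)) * indicator B p \<partial>lebesgue_on_interval r)"
    by (subst emeasure_density) auto
  also have "\<dots> = (\<integral>\<^sup>+x. ennreal (equilibrium_density r x) * indicator B (of_affine x) \<partial>restrict_space lborel {-r..r})"
    unfolding lebesgue_on_interval_def by (subst nn_integral_distr) auto
  also have "\<dots> = (\<integral>\<^sup>+x. ennreal (equilibrium_density r x) * indicator B (of_affine x) * indicator {-r..r} x \<partial>lborel)"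
    by (subst nn_integral_restrict_space) auto
  also have "\<dots> = (\<integral>\<^sup>+x. indicator B (of_affine x) * law_density r x \<partial>lborel)"
    using AE_law_density[OF r]
  proof (intro nn_integral_cong_AE, eventually_elim)
    case (elim x)
    then show ?case using law_density_outside[OF r, of x]
      by (cases "\<bar>x\<bar> \<le> r") (auto simp: indicator_def abs_le_iff)
  qed
  also have "\<dots> = (\<integral>\<^sup>+x. indicator B (of_affine x) \<partial>equilibrium_law r)"
    by (rule nn_integral_equilibrium_law_density[OF r, symmetric]) measurable
  also have "\<dots> = emeasure (distr (equilibrium_law r) borel of_affine) B"
    by (rule emeasure_distr_nn_integral[symmetric]) measurable
  finally show "emeasure (density (lebesgue_on_interval r) (\<lambda>p. ennreal (equilibrium_density r (affine_coord p)))) B =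
      emeasure (distr (equilibrium_law r) borel of_affine) B" .
qed

text \<open>Required for the almost everywhere uniqueness of the Radon-Nikodym derivative.\<close>

lemma sigma_finite_lebesgue_on_interval: "sigma_finite_measure (lebesgue_on_interval r)"
proof -
  have "finite_measure (restrict_space lborel {-r..r})"
    by (rule finite_measureI) (simp add: emeasure_restrict_space space_restrict_space emeasure_lborel_Icc_eq)
  then interpret finite_measure "lebesgue_on_interval r"
    unfolding lebesgue_on_interval_def
    by (rule finite_measure.finite_measure_distr) (rule measurable_restrict_space1, simp)
  show ?thesis by unfold_locales
qed

lemma AE_lebesgue_on_interval:
  assumes [measurable]: "Measurable.pred borel P"
  shows "(AE p in lebesgue_on_interval r. P p) \<longleftrightarrow> (AE x in lborel. x \<in> {-r..r} \<longrightarrow> P (of_affine x))"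
proof -
  have [measurable]: "of_affine \<in> restrict_space lborel {-r..r} \<rightarrow>\<^sub>M borel"
    by (rule measurable_restrict_space1) simp
  show ?thesis
    unfolding lebesgue_on_interval_def
    by (subst AE_distr_iff) (auto simp: AE_restrict_space_iff)
qed

theorem theorem2:
  fixes r :: real
  assumes "r > 0"
  defines "E \<equiv> affine_interval r"
  defines "\<mu> \<equiv> delta_equilibrium E"
  shows "absolutely_continuous (lebesgue_on_interval r) \<mu> \<and>
    (AE x in lborel. x \<in> {-r..r} \<longrightarrow>
       enn2ereal (RN_deriv (lebesgue_on_interval r) \<mu> (of_affine x)) =
         ereal (equilibrium_density r x)) \<and>
    delta_robin E = ereal
      (if r \<ge> 1 then
         ln (2 / r) + 2 / pi * (LBINT x:{1..r}. ln x / sqrt (r\<^sup>2 - x\<^sup>2))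
           + 2 * (LINT p:of_affine ` {1..r}|\<mu>. ln (affine_coord p))
       else ln (2 / r))"
proof (intro conjI)
  let ?L = "lebesgue_on_interval r" and ?f = "\<lambda>p. ennreal (equilibrium_density r (affine_coord p))"
  have \<mu>: "\<mu> = distr (equilibrium_law r) borel of_affine"
    unfolding \<mu>_def E_def by (rule equilibrium_law_Frostman(1)[OF assms(1)])
  have density: "density ?L ?f = \<mu>"
    unfolding \<mu> by (rule density_lebesgue_on_interval[OF assms(1)])
  have [measurable]: "equilibrium_density r \<in> borel_measurable borel"
    unfolding equilibrium_density_def by measurable
  have [measurable_cong]: "sets ?L = sets borel" by (simp add: lebesgue_on_interval_def)
  have f: "?f \<in> borel_measurable ?L" by measurable
  show "absolutely_continuous ?L \<mu>"
    unfolding density[symmetric] by (rule absolutely_continuousI_density[OF f])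
  have "AE p in ?L. ?f p = RN_deriv ?L \<mu> p"
    by (rule sigma_finite_measure.RN_deriv_unique[OF sigma_finite_lebesgue_on_interval f density])
  moreover have "RN_deriv ?L \<mu> \<in> borel_measurable borel"
    using borel_measurable_RN_deriv[of ?L \<mu>] by measurable
  ultimately have "AE x in lborel. x \<in> {-r..r} \<longrightarrow> ?f (of_affine x) = RN_deriv ?L \<mu> (of_affine x)"
    by (subst (asm) AE_lebesgue_on_interval) auto
  with AE_law_density[OF assms(1)]
  show "AE x in lborel. x \<in> {-r..r} \<longrightarrow>
      enn2ereal (RN_deriv ?L \<mu> (of_affine x)) = ereal (equilibrium_density r x)"
  proof eventually_elim
    case (elim x)
    show ?case
    proof
      assume "x \<in> {-r..r}"
      with elim have "RN_deriv ?L \<mu> (of_affine x) = ennreal (equilibrium_density r x)"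
        "0 \<le> equilibrium_density r x" by (auto simp: abs_le_iff)
      then show "enn2ereal (RN_deriv ?L \<mu> (of_affine x)) = ereal (equilibrium_density r x)"
        by (simp add: enn2ereal_ennreal)
    qed
  qed
  have robin: "delta_robin E = ereal (ln (2 / r) + (\<integral>s. max 0 (ln (r * \<bar>cos s\<bar>)) \<partial>angle_measure) +
      2 * (\<integral>x. indicator {1..r} x * ln x \<partial>equilibrium_law r))"
    unfolding E_def equilibrium_law_Frostman(2)[OF assms(1)] robin_shift_eq[OF assms(1)] ..
  show "delta_robin E = ereal
      (if r \<ge> 1 then
         ln (2 / r) + 2 / pi * (LBINT x:{1..r}. ln x / sqrt (r\<^sup>2 - x\<^sup>2))
           + 2 * (LINT p:of_affine ` {1..r}|\<mu>. ln (affine_coord p))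
       else ln (2 / r))"
  proof (cases "r \<ge> 1")
    case True
    then show ?thesis
      unfolding robin \<mu> set_integral_of_affine integral_positive_log_cos[OF True] by simp
  next
    case False
    \<comment> \<open>For \<open>r < 1\<close> the argument never exceeds 1; at
      \<open>cos s = 0\<close> the convention \<open>ln 0 = 0\<close> gives the same value. The
      integral over \<open>[1, r]\<close> vanishes as well, since that interval is empty.\<close>
    have "max 0 (ln (r * \<bar>cos s\<bar>)) = 0" for s
    proof (cases "cos s = 0")
      case False
      have "r * \<bar>cos s\<bar> \<le> 1"
        using \<open>\<not> r \<ge> 1\<close> assms(1) mult_mono[of r 1 "\<bar>cos s\<bar>" 1] by simp
      then have "ln (r * \<bar>cos s\<bar>) \<le> 0" using False assms(1) by (subst ln_le_zero_iff) auto
      then show ?thesis by simp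
    qed simp
    then show ?thesis using False unfolding robin by simp
  qed
qed

end
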